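(* Let $D=D_1\cup\dots\cup D_d$ be a diagram of an oriented virtual link $\mathcal L$ with $d$ components, let $p$ be an oriented parity on the diagrams of $\mathcal L$ with coefficients in an abelian group $A$, and let $\delta^p$ be the parity cycle of $p$. (1) For any self-crossing $v$ of a component $D_i$, $$p_D(v)=(D_i)^l_v\cdot\delta^p_D,$$ where $(D_i)^l_v$ is the left half of the component $D_i$ at $v$. (2) Let $v$ and $w$ be distinct crossings of two different components $D_i$ and $D_j$. Denote by $\gamma_1$ the path from $v$ to $w$ in $D_i$ (along the orientation of the component) and by $\gamma_2$ the path from $w$ to $v$ in $D_j$ (along the orientation), and let $\gamma=\gamma_1\gamma_2$. Then $$\eta_\gamma(v)\,p_D(v)+\eta_\gamma(w)\,p_D(w)=\gamma\cdot\delta^p_D,$$ where $\eta_\gamma(v),\eta_\gamma(w)$ are the incidence indices of the crossings $v$ and $w$ to the cycle $\gamma$.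
   Context: Diagrams. A virtual link diagram $D=D_1\cup\dots\cup D_d$ is a generic collection of oriented closed curves in the plane whose double points are marked classical (with over/under information) or virtual. A virtual link is a class of diagrams modulo isotopy, classical Reidemeister moves R1, R2, R3 and detour moves (replacing a path containing only virtual crossings by another path with the same ends containing only virtual crossings). $\mathcal V(D)$ is the set of classical crossings; $\mathcal A(D)$ is the set of arcs, i.e. pieces of $D$ between consecutive classical crossings (a component without classical crossings is one closed arc). A move $f\colon D\to D'$ induces a partial bijection $f_*\colon\mathcal V(D)\to\mathcal V(D')$ between surviving crossings. Local picture. Draw a classical crossing $v$ with both strands directed upward: the incoming arcs are SW, SE, the outgoing ones NW, NE, and the strands run SW$\to$NE and SE$\to$NW. If $v$ is a self-crossing of $D_i$, the left half $(D_i)^l_v$ is the closed path in $D_i$ leaving $v$ along NW and returning along SW. If a cycle $\gamma$ turns at $v$ from one strand to the other, then $\eta_\gamma(v)=+1$ if $\gamma$ enters $v$ along SW and leaves along NW, and $\eta_\gamma(v)=-1$ if $\gamma$ enters along SE and leaves along NE. Chains. $C_1(D,A)$ is the group of $A$-linear combinations of arcs, i.e. 1-chains of the graph $\tilde D$ with vertices $\mathcal V(D)$ and edges $\mathcal A(D)$ oriented along $D$. $\tilde D$ is embedded in the closed oriented surface $AD(D)$ obtained by gluing discs to the boundary of the ribbon surface that is the (immersed) neighbourhood of $D$ (virtual crossings not being vertices). $C_1\cdot C_2$ is the intersection number of cycles in $AD(D)$, a transverse intersection counting $+1$ when (tangent of $C_1$, tangent of $C_2$) is positively oriented. Oriented parity.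 A family of maps $p_D\colon\mathcal V(D)\to A$ for all diagrams $D$ of $\mathcal L$ such that: (P0) $p_D(v)=p_{D'}(f_*(v))$ for every move $f\colon D\to D'$ and every $v$ for which $f_*(v)$ exists; (P1) $p_D(v)=0$ if $v$ disappears in a decreasing R1; (P2) $p_D(v_1)+p_D(v_2)=0$ if $v_1,v_2$ disappear in a decreasing R2; (P3+) $\sum_{i=1}^3\epsilon_\Delta(v_i)p_D(v_i)=0$ if $v_1,v_2,v_3$ are the vertices of the disappearing triangle $\Delta$ of an R3, where $\epsilon_\Delta(v)=+1$ if $\Delta$ lies to the left or right of $v$ in the local picture (between SW and NW, or between SE and NE) and $-1$ if it lies above or below $v$. Parity cycle. For $a\in\mathcal A(D)$ take two disjoint subsegments of $a$, bring them by detour moves side by side, parallel and in the same direction, and apply an increasing R2 to them. Let $v$ be the new crossing at which both strands enter the new bigon. Then $\delta_a$ is the value of $p$ at $v$ (it does not depend on the choices), and $\delta^p_D=\sum_{a\in\mathcal A(D)}\delta_a\cdot a$; it is a 1-cycle. *)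

theory Defs
  imports Main "HOL-Combinatorics.Transposition" "HOL-Combinatorics.Permutations"
begin

section \<open>Virtual link diagrams\<close>

text \<open>
  A plane diagram is recorded, up to plane isotopy and detour moves, by its Gauss code: for every
  component the cyclic word of its passages through classical crossings, together with the signs of
  these crossings. Virtual crossings leave no trace in the code; they can be recovered, uniquely up
  to isotopies and detour moves, by drawing the arcs of the code in the plane. The passage
  \<open>(v, True)\<close> is the upper one and \<open>(v, False)\<close> the lower one at the crossing \<open>v\<close>; \<open>positive D v\<close>
  says that \<open>v\<close> has sign \<open>+1\<close>. The empty word is a component without classical crossings.
\<close>

type_synonym passage = "nat \<times> bool"

record vdiagram =
  comps :: "passage list list"
  positive :: "nat \<Rightarrow> bool"

definition crossings :: "vdiagram \<Rightarrow> nat set" where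
  "crossings D = fst ` set (concat (comps D))"

definition diagram :: "vdiagram \<Rightarrow> bool" where
  "diagram D \<longleftrightarrow> distinct (concat (comps D)) \<and>
     (\<forall>v b. (v, b) \<in> set (concat (comps D)) \<longrightarrow> (v, \<not> b) \<in> set (concat (comps D)))"

text \<open>
  The arc \<open>(i, k)\<close> starts at the passage number \<open>k\<close> of the component \<open>i\<close> and ends at the cyclically
  next passage. A component without crossings consists of the single closed arc \<open>(i, 0)\<close>.
\<close>

type_synonym arc = "nat \<times> nat"

definition arcs :: "vdiagram \<Rightarrow> arc set" where
  "arcs D = {(i, k). i < length (comps D) \<and> k < max 1 (length (comps D ! i))}"

definition tail :: "vdiagram \<Rightarrow> arc \<Rightarrow> passage" where
  "tail D a = (case a of (i, k) \<Rightarrow> comps D ! i ! k)"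

definition head :: "vdiagram \<Rightarrow> arc \<Rightarrow> passage" where
  "head D a = (case a of (i, k) \<Rightarrow> comps D ! i ! (Suc k mod length (comps D ! i)))"

definition open_arcs :: "vdiagram \<Rightarrow> arc set" where
  "open_arcs D = {(i, k). i < length (comps D) \<and> k < length (comps D ! i)}"

definition arc_from :: "vdiagram \<Rightarrow> passage \<Rightarrow> arc" where
  "arc_from D x = (THE a. a \<in> open_arcs D \<and> tail D a = x)"

definition arc_to :: "vdiagram \<Rightarrow> passage \<Rightarrow> arc" where
  "arc_to D x = (THE a. a \<in> open_arcs D \<and> head D a = x)"


section \<open>The local picture\<close>

text \<open>
  With both strands directed upward, the strand from SW to NE is the upper one at a positive
  crossing and the lower one at a negative crossing.
\<close>

definition sw :: "vdiagram \<Rightarrow> nat \<Rightarrow> arc" where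
  "sw D v = arc_to D (v, positive D v)"

definition ne :: "vdiagram \<Rightarrow> nat \<Rightarrow> arc" where
  "ne D v = arc_from D (v, positive D v)"

definition se :: "vdiagram \<Rightarrow> nat \<Rightarrow> arc" where
  "se D v = arc_to D (v, \<not> positive D v)"

definition nw :: "vdiagram \<Rightarrow> nat \<Rightarrow> arc" where
  "nw D v = arc_from D (v, \<not> positive D v)"

text \<open>
  The four quadrants at a crossing are the corners of the faces of \<open>AD(D)\<close>. Traverse the boundary of
  a face with the face on the left; a dart \<open>(a, True)\<close> follows the arc \<open>a\<close> along its orientation,
  \<open>(a, False)\<close> against it. The functions \<open>enter\<close> and \<open>leave\<close> give the darts of this traversal before
  and after a corner.
\<close>

datatype quadrant = West | East | North | South

type_synonym corner = "nat \<times> quadrant"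
type_synonym dart = "arc \<times> bool"

fun enter :: "vdiagram \<Rightarrow> corner \<Rightarrow> dart" where
  "enter D (v, West) = (sw D v, True)"
| "enter D (v, South) = (se D v, True)"
| "enter D (v, East) = (ne D v, False)"
| "enter D (v, North) = (nw D v, False)"

fun leave :: "vdiagram \<Rightarrow> corner \<Rightarrow> dart" where
  "leave D (v, West) = (nw D v, True)"
| "leave D (v, South) = (sw D v, False)"
| "leave D (v, East) = (se D v, False)"
| "leave D (v, North) = (ne D v, True)"

text \<open>The disc glued to a boundary component of the ribbon surface, given by its successive corners.\<close>

definition face :: "vdiagram \<Rightarrow> corner list \<Rightarrow> bool" where
  "face D cs \<longleftrightarrow> cs \<noteq> [] \<and> distinct cs \<and> fst ` set cs \<subseteq> crossings D \<and>
     (\<forall>k < length cs. leave D (cs ! k) = enter D (cs ! (Suc k mod length cs)))"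

definition sides :: "vdiagram \<Rightarrow> corner list \<Rightarrow> arc list" where
  "sides D cs = map (fst \<circ> leave D) cs"


section \<open>Moves\<close>

text \<open>
  Isotopies and detour moves change the plane picture but not the Gauss code, except for the names
  of the crossings, the numbering of the components and the starting points of the words.
\<close>

definition detour_iso :: "vdiagram \<Rightarrow> vdiagram \<Rightarrow> (nat \<Rightarrow> nat) \<Rightarrow> bool" where
  "detour_iso D D' g \<longleftrightarrow>
     bij_betw g (crossings D) (crossings D') \<and>
     (\<forall>v \<in> crossings D. positive D' (g v) = positive D v) \<and>
     length (comps D') = length (comps D) \<and>
     (\<exists>\<pi>. \<pi> permutes {..<length (comps D)} \<and>
       (\<forall>i < length (comps D). \<exists>r.
          comps D' ! \<pi> i = rotate r (map (map_prod g id) (comps D ! i))))"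

definition remove :: "nat set \<Rightarrow> vdiagram \<Rightarrow> vdiagram" where
  "remove S D = D\<lparr>comps := map (filter (\<lambda>x. fst x \<notin> S)) (comps D)\<rparr>"

definition R1_dec :: "nat \<Rightarrow> vdiagram \<Rightarrow> vdiagram \<Rightarrow> bool" where
  "R1_dec v D D' \<longleftrightarrow> (\<exists>q. face D [(v, q)]) \<and> D' = remove {v} D"

definition upper_side :: "vdiagram \<Rightarrow> arc \<Rightarrow> bool" where
  "upper_side D a \<longleftrightarrow> snd (tail D a) \<and> snd (head D a)"

definition lower_side :: "vdiagram \<Rightarrow> arc \<Rightarrow> bool" where
  "lower_side D a \<longleftrightarrow> \<not> snd (tail D a) \<and> \<not> snd (head D a)"

definition R2_dec :: "nat \<Rightarrow> nat \<Rightarrow> vdiagram \<Rightarrow> vdiagram \<Rightarrow> bool" where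
  "R2_dec v1 v2 D D' \<longleftrightarrow> v1 \<noteq> v2 \<and>
     (\<exists>q1 q2. face D [(v1, q1), (v2, q2)] \<and>
        (\<exists>a \<in> set (sides D [(v1, q1), (v2, q2)]). upper_side D a) \<and>
        (\<exists>a \<in> set (sides D [(v1, q1), (v2, q2)]). lower_side D a)) \<and>
     D' = remove {v1, v2} D"

text \<open>
  The third Reidemeister move exchanges the two passages at the ends of each side of the triangle.
  A crossing of two of the three strands is identified with the crossing of the same strands
  after the move.
\<close>

definition exchange_ends :: "vdiagram \<Rightarrow> arc list \<Rightarrow> passage \<Rightarrow> passage" where
  "exchange_ends D es x = foldr (\<lambda>a. transpose (tail D a) (head D a)) es x"

definition R3 :: "corner list \<Rightarrow> vdiagram \<Rightarrow> vdiagram \<Rightarrow> bool" where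
  "R3 \<Delta> D D' \<longleftrightarrow> length \<Delta> = 3 \<and> distinct (map fst \<Delta>) \<and> face D \<Delta> \<and>
     (\<exists>a \<in> set (sides D \<Delta>). upper_side D a) \<and> (\<exists>a \<in> set (sides D \<Delta>). lower_side D a) \<and>
     D' = D\<lparr>comps := map (map (exchange_ends D (sides D \<Delta>))) (comps D)\<rparr>"

definition reidemeister :: "vdiagram \<Rightarrow> vdiagram \<Rightarrow> bool" where
  "reidemeister D D' \<longleftrightarrow>
     (\<exists>v. R1_dec v D D') \<or> (\<exists>v1 v2. R2_dec v1 v2 D D') \<or> (\<exists>\<Delta>. R3 \<Delta> D D')"

text \<open>\<open>move D D' f\<close>: a move from \<open>D\<close> to \<open>D'\<close> which induces the partial bijection \<open>f\<close> of crossings.\<close>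

inductive move :: "vdiagram \<Rightarrow> vdiagram \<Rightarrow> (nat \<rightharpoonup> nat) \<Rightarrow> bool" where
  iso: "\<lbrakk>diagram D; diagram D'; detour_iso D D' g\<rbrakk>
    \<Longrightarrow> move D D' (\<lambda>v. if v \<in> crossings D then Some (g v) else None)"
| reidemeister: "\<lbrakk>diagram D; diagram D'; reidemeister D D' \<or> reidemeister D' D\<rbrakk>
    \<Longrightarrow> move D D' (\<lambda>v. if v \<in> crossings D \<inter> crossings D' then Some v else None)"

definition virtual_link :: "vdiagram set \<Rightarrow> bool" where
  "virtual_link L \<longleftrightarrow>
     L \<in> {D. diagram D} //
       {(D, D'). diagram D \<and> diagram D' \<and> equivclp (\<lambda>D D'. \<exists>f. move D D' f) D D'}"


section \<open>Chains and the intersection number\<close>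

definition int_scale :: "int \<Rightarrow> 'a::ab_group_add \<Rightarrow> 'a" where
  "int_scale n x = (\<Sum>k<nat n. x) - (\<Sum>k<nat (- n). x)"

text \<open>A walk in the graph of the diagram is the list of its arcs, all followed along the orientation.\<close>

definition chain :: "arc list \<Rightarrow> arc \<Rightarrow> int" where
  "chain w a = int (count_list w a)"

text \<open>
  The intersection number in \<open>AD(D)\<close> of cycles \<open>x\<close> and \<open>y\<close> of the graph. Push the cycle \<open>x\<close> off the
  graph to the left of the oriented arcs. Near a crossing \<open>v\<close> the pushed copies of the two strands
  meet in the quadrant West. There the copy of the strand from SW to NE crosses the arc NW, once and
  from left to right, so that (tangent of \<open>x\<close>, tangent of \<open>y\<close>) is positively oriented; the copy of the
  strand from SE to NW crosses the arc SW, with the opposite sign. At these points the copies carry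
  the coefficients of \<open>x\<close> at NE and at SE. There are no other intersection points.
\<close>

definition intersection ::
    "vdiagram \<Rightarrow> (arc \<Rightarrow> int) \<Rightarrow> (arc \<Rightarrow> 'a::ab_group_add) \<Rightarrow> 'a" where
  "intersection D x y =
     (\<Sum>v \<in> crossings D. int_scale (x (ne D v)) (y (nw D v)) - int_scale (x (se D v)) (y (sw D v)))"


lemma nth_concat_inj:
  assumes "distinct (concat xss)" "i < length xss" "j < length xss"
    "k < length (xss ! i)" "l < length (xss ! j)" "xss ! i ! k = xss ! j ! l"
  shows "i = j \<and> k = l"
  using assms
proof (induction xss arbitrary: i j)
  case (Cons xs xss)
  have d: "distinct xs" "distinct (concat xss)" "set xs \<inter> set (concat xss) = {}"
    using Cons.prems(1) by auto
  have mem: "xss ! m ! n \<in> set (concat xss)" if "m < length xss" "n < length (xss ! m)" for m n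
    using that by (auto intro!: bexI[of _ "xss ! m"])
  show ?case
  proof (cases i; cases j)
    assume "i = 0" "j = 0"
    then show ?thesis using Cons.prems d by (simp add: nth_eq_iff_index_eq)
  next
    fix j' assume "i = 0" "j = Suc j'"
    then have "xs ! k \<in> set (concat xss)" "xs ! k \<in> set xs"
      using Cons.prems mem[of j' l] nth_mem[of k xs] by (auto simp del: set_concat)
    then show ?thesis using d by blast
  next
    fix i' assume "i = Suc i'" "j = 0"
    then have "xs ! l \<in> set (concat xss)" "xs ! l \<in> set xs"
      using Cons.prems mem[of i' k] nth_mem[of l xs] by (auto simp del: set_concat)
    then show ?thesis using d by blast
  next
    fix i' j' assume "i = Suc i'" "j = Suc j'"
    then show ?thesis using Cons.prems d Cons.IH[of i' j'] by auto
  qed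
qed simp

lemma bij_betw_tail:
  assumes "diagram D" shows "bij_betw (tail D) (open_arcs D) (set (concat (comps D)))"
  unfolding bij_betw_def
proof
  show "inj_on (tail D) (open_arcs D)"
    using assms nth_concat_inj[of "comps D"]
    by (auto simp: inj_on_def diagram_def open_arcs_def tail_def split: prod.splits)
  show "tail D ` open_arcs D = set (concat (comps D))"
  proof (intro equalityI subsetI)
    fix x assume "x \<in> tail D ` open_arcs D"
    then show "x \<in> set (concat (comps D))" 
      by (auto simp: open_arcs_def tail_def intro!: nth_mem bexI[where x = "comps D ! _"])
  next
    fix x assume "x \<in> set (concat (comps D))"
    then obtain w where "w \<in> set (comps D)" "x \<in> set w" by auto
    then obtain i k where "i < length (comps D)" "w = comps D ! i" "k < length w" "x = w ! k"
      by (metis in_set_conv_nth)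
    then show "x \<in> tail D ` open_arcs D"
      by (auto simp: open_arcs_def tail_def intro!: image_eqI[of _ _ "(i, k)"])
  qed
qed

lemma finite_open_arcs: "finite (open_arcs D)"
proof -
  have "open_arcs D = (SIGMA i:{..<length (comps D)}. {..<length (comps D ! i)})"
    by (auto simp: open_arcs_def)
  then show ?thesis by simp
qed

lemma Suc_mod_inj: "k < n \<Longrightarrow> l < n \<Longrightarrow> Suc k mod n = Suc l mod n \<Longrightarrow> k = l"
  by (auto simp: mod_Suc split: if_splits)

lemma bij_betw_head:
  assumes "diagram D" shows "bij_betw (head D) (open_arcs D) (set (concat (comps D)))"
proof -
  let ?s = "\<lambda>(i, k). (i, Suc k mod length (comps D ! i))"
  have "?s ` open_arcs D \<subseteq> open_arcs D"
    by (auto simp: open_arcs_def intro!: mod_less_divisor)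
  moreover have inj: "inj_on ?s (open_arcs D)"
    by (auto simp: inj_on_def open_arcs_def dest: Suc_mod_inj)
  ultimately have "bij_betw ?s (open_arcs D) (open_arcs D)"
    using endo_inj_surj[OF finite_open_arcs, of ?s] by (simp add: bij_betw_def)
  then have "bij_betw (tail D \<circ> ?s) (open_arcs D) (set (concat (comps D)))"
    using bij_betw_tail[OF assms] by (rule bij_betw_trans)
  moreover have "tail D \<circ> ?s = head D" by (auto simp: tail_def head_def)
  ultimately show ?thesis by simp
qed

lemma passages_crossings:
  assumes "diagram D" shows "set (concat (comps D)) = crossings D \<times> UNIV"
proof -
  have "(v, b) \<in> set (concat (comps D))" if "v \<in> crossings D" for v b
  proof -
    obtain c where "(v, c) \<in> set (concat (comps D))"
      using \<open>v \<in> crossings D\<close> unfolding crossings_def by (metis imageE prod.collapse)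
    then show ?thesis using assms by (cases "b = c") (auto simp: diagram_def simp del: set_concat)
  qed
  moreover have "x \<in> crossings D \<times> UNIV" if "x \<in> set (concat (comps D))" for x
    using that by (simp add: crossings_def mem_Times_iff del: set_concat)
  ultimately show ?thesis by (auto simp del: set_concat)
qed

lemma the_bij:
  assumes "bij_betw f A B" "y \<in> B"
  shows "(THE a. a \<in> A \<and> f a = y) \<in> A \<and> f (THE a. a \<in> A \<and> f a = y) = y"
proof -
  have "\<exists>!a. a \<in> A \<and> f a = y"
    using assms by (auto simp: bij_betw_def inj_on_def)
  then show ?thesis by (rule theI')
qed

lemma arc_from:
  assumes "diagram D" "v \<in> crossings D"
  shows "arc_from D (v, b) \<in> open_arcs D" "tail D (arc_from D (v, b)) = (v, b)"
  using the_bij[OF bij_betw_tail[OF assms(1)], of "(v, b)"] assms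
  by (auto simp: arc_from_def passages_crossings simp del: set_concat)

lemma arc_to:
  assumes "diagram D" "v \<in> crossings D"
  shows "arc_to D (v, b) \<in> open_arcs D" "head D (arc_to D (v, b)) = (v, b)"
  using the_bij[OF bij_betw_head[OF assms(1)], of "(v, b)"] assms
  by (auto simp: arc_to_def passages_crossings simp del: set_concat)

lemma sum_passages:
  assumes "finite V"
  shows "(\<Sum>x \<in> V \<times> (UNIV::bool set). h x) = (\<Sum>v\<in>V. h (v, s v) + h (v, \<not> s v))"
proof -
  have fiber: "(\<Sum>b\<in>UNIV. h (v, b)) = h (v, s v) + h (v, \<not> s v)" for v
    by (cases "s v") (auto simp: UNIV_bool add.commute)
  have "(\<Sum>x \<in> V \<times> (UNIV::bool set). h x) = (\<Sum>v\<in>V. \<Sum>b\<in>UNIV. h (v, b))"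
    using assms by (simp add: sum.cartesian_product)
  also have "\<dots> = (\<Sum>v\<in>V. h (v, s v) + h (v, \<not> s v))"
    by (rule sum.cong) (use fiber in simp_all)
  finally show ?thesis .
qed

lemma sum_out:
  assumes "diagram D"
  shows "(\<Sum>v\<in>crossings D. h (ne D v) + h (nw D v)) = sum h (open_arcs D)"
proof -
  have inv: "arc_from D (tail D a) = a" if "a \<in> open_arcs D" for a
    using that bij_betw_tail[OF assms] unfolding arc_from_def
    by (auto simp: bij_betw_def inj_on_def intro!: the_equality)
  have "(\<Sum>v\<in>crossings D. h (ne D v) + h (nw D v))
      = (\<Sum>x\<in>set (concat (comps D)). h (arc_from D x))"
    unfolding passages_crossings[OF assms] ne_def nw_def
    by (subst sum_passages[where s="positive D"]) (auto simp: crossings_def)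
  also have "\<dots> = (\<Sum>a\<in>open_arcs D. h (arc_from D (tail D a)))"
    by (rule sum.reindex_bij_betw[OF bij_betw_tail[OF assms], symmetric])
  finally show ?thesis by (simp add: inv cong: sum.cong)
qed

lemma sum_in:
  assumes "diagram D"
  shows "(\<Sum>v\<in>crossings D. h (sw D v) + h (se D v)) = sum h (open_arcs D)"
proof -
  have inv: "arc_to D (head D a) = a" if "a \<in> open_arcs D" for a
    using that bij_betw_head[OF assms] unfolding arc_to_def
    by (auto simp: bij_betw_def inj_on_def intro!: the_equality)
  have "(\<Sum>v\<in>crossings D. h (sw D v) + h (se D v))
      = (\<Sum>x\<in>set (concat (comps D)). h (arc_to D x))"
    unfolding passages_crossings[OF assms] sw_def se_def
    by (subst sum_passages[where s="positive D"]) (auto simp: crossings_def)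
  also have "\<dots> = (\<Sum>a\<in>open_arcs D. h (arc_to D (head D a)))"
    by (rule sum.reindex_bij_betw[OF bij_betw_head[OF assms], symmetric])
  finally show ?thesis by (simp add: inv cong: sum.cong)
qed

definition is_cycle :: "vdiagram \<Rightarrow> (arc \<Rightarrow> 'a::ab_group_add) \<Rightarrow> bool" where
  "is_cycle D y \<longleftrightarrow> (\<forall>v \<in> crossings D. y (sw D v) + y (se D v) = y (nw D v) + y (ne D v))"

text \<open>
  The pairing is skew-symmetric on cycles and vanishes on the boundaries of the faces, hence depends
  only on the homology classes in \<open>AD(D)\<close>.
\<close>

lemma int_scale_int: "int_scale n (x::int) = n * x"
  by (cases "n \<ge> 0") (auto simp: int_scale_def)

lemma intersection_antisym:
  fixes x y :: "arc \<Rightarrow> int"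
  assumes "diagram D" "is_cycle D x" "is_cycle D y"
  shows "intersection D x y = - intersection D y x"
proof -
  have "intersection D x y + intersection D y x =
    (\<Sum>v\<in>crossings D. (x (sw D v) * y (sw D v) + x (se D v) * y (se D v))
       - (x (ne D v) * y (ne D v) + x (nw D v) * y (nw D v)))"
    unfolding intersection_def int_scale_int sum.distrib[symmetric]
  proof (rule sum.cong)
    fix v assume "v \<in> crossings D"
    then have "(x (sw D v) + x (se D v)) * (y (sw D v) + y (se D v)) =
        (x (nw D v) + x (ne D v)) * (y (nw D v) + y (ne D v))"
      using assms unfolding is_cycle_def by simp
    then show "x (ne D v) * y (nw D v) - x (se D v) * y (sw D v) +
         (y (ne D v) * x (nw D v) - y (se D v) * x (sw D v)) =
         x (sw D v) * y (sw D v) + x (se D v) * y (se D v) -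
         (x (ne D v) * y (ne D v) + x (nw D v) * y (nw D v))"
      by (simp add: algebra_simps)
  qed simp
  also have "\<dots> = 0"
    using sum_out[OF assms(1), of "\<lambda>a. x a * y a"] sum_in[OF assms(1), of "\<lambda>a. x a * y a"]
    by (simp add: sum_subtractf)
  finally show ?thesis by simp
qed

definition face_boundary :: "vdiagram \<Rightarrow> corner list \<Rightarrow> arc \<Rightarrow> int" where
  "face_boundary D cs a =
     of_bool ((a, True) \<in> leave D ` set cs) - of_bool ((a, False) \<in> leave D ` set cs)"

lemma ends_inj:
  assumes "diagram D" "v \<in> crossings D" "v' \<in> crossings D"
  shows "arc_from D (v, b) = arc_from D (v', b') \<longleftrightarrow> v = v' \<and> b = b'"
    and "arc_to D (v, b) = arc_to D (v', b') \<longleftrightarrow> v = v' \<and> b = b'"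
proof -
  have "(v, b) = (v', b')" if "arc_from D (v, b) = arc_from D (v', b')"
    using arg_cong[OF that, of "tail D"] arc_from(2)[OF assms(1)] assms(2,3) by (simp only:)
  then show "arc_from D (v, b) = arc_from D (v', b') \<longleftrightarrow> v = v' \<and> b = b'"
    by blast
  have "(v, b) = (v', b')" if "arc_to D (v, b) = arc_to D (v', b')"
    using arg_cong[OF that, of "head D"] arc_to(2)[OF assms(1)] assms(2,3) by (simp only:)
  then show "arc_to D (v, b) = arc_to D (v', b') \<longleftrightarrow> v = v' \<and> b = b'"
    by blast
qed

lemma enter_inj:
  assumes "diagram D" "fst c \<in> crossings D" "fst c' \<in> crossings D" "enter D c = enter D c'"
  shows "c = c'"
proof -
  obtain v q v' q' where [simp]: "c = (v, q)" "c' = (v', q')" by (cases c; cases c')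
  have v: "v \<in> crossings D" "v' \<in> crossings D" using assms by simp_all
  show ?thesis
    using assms(4)
    by (cases q; cases q')
       (auto simp: sw_def se_def ne_def nw_def ends_inj[OF assms(1) v])
qed

lemma leave_inj:
  assumes "diagram D" "fst c \<in> crossings D" "fst c' \<in> crossings D" "leave D c = leave D c'"
  shows "c = c'"
proof -
  obtain v q v' q' where [simp]: "c = (v, q)" "c' = (v', q')" by (cases c; cases c')
  have v: "v \<in> crossings D" "v' \<in> crossings D" using assms by simp_all
  show ?thesis
    using assms(4)
    by (cases q; cases q')
       (auto simp: sw_def se_def ne_def nw_def ends_inj[OF assms(1) v])
qed

lemma face_darts:
  assumes "face D cs" shows "enter D ` set cs = leave D ` set cs"
proof -
  let ?n = "length cs"
  have n: "?n > 0" using assms by (auto simp: face_def)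
  have st: "leave D (cs ! k) = enter D (cs ! (Suc k mod ?n))" if "k < ?n" for k
    using assms that unfolding face_def by blast
  have cs: "set cs = (!) cs ` {..<?n}" by (auto simp: set_conv_nth)
  have surj: "(\<lambda>k. Suc k mod ?n) ` {..<?n} = {..<?n}"
  proof (rule endo_inj_surj)
    show "(\<lambda>k. Suc k mod ?n) ` {..<?n} \<subseteq> {..<?n}" using n by auto
    show "inj_on (\<lambda>k. Suc k mod ?n) {..<?n}" by (auto simp: inj_on_def dest: Suc_mod_inj)
  qed simp
  have "leave D ` set cs = (\<lambda>k. enter D (cs ! k)) ` (\<lambda>k. Suc k mod ?n) ` {..<?n}"
    unfolding cs image_image using st by (intro image_cong) auto
  also have "\<dots> = enter D ` set cs" by (simp only: surj cs image_image)
  finally show ?thesis by simp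
qed

lemma intersection_face_boundary:
  fixes y :: "arc \<Rightarrow> 'a::ab_group_add"
  assumes D: "diagram D" and F: "face D cs" and y: "is_cycle D y"
  shows "intersection D (face_boundary D cs) y = 0"
proof -
  define F where "F = leave D ` set cs"
  have corner: "enter D c \<in> F \<longleftrightarrow> c \<in> set cs" "leave D c \<in> F \<longleftrightarrow> c \<in> set cs"
    if "fst c \<in> crossings D" for c
  proof -
    have cs: "fst ` set cs \<subseteq> crossings D" using F by (auto simp: face_def)
    show "enter D c \<in> F \<longleftrightarrow> c \<in> set cs"
      unfolding F_def face_darts[OF F, symmetric] using enter_inj[OF D that] cs by blast
    show "leave D c \<in> F \<longleftrightarrow> c \<in> set cs"
      unfolding F_def using leave_inj[OF D that] cs by blast
  qed
  define h where "h a = (if (a, False) \<in> F then y a else 0)" for a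
  have "intersection D (face_boundary D cs) y =
     (\<Sum>v\<in>crossings D. (h (ne D v) + h (nw D v)) - (h (sw D v) + h (se D v)))"
    unfolding intersection_def
  proof (rule sum.cong)
    fix v assume v: "v \<in> crossings D"
    have yv: "y (ne D v) = y (sw D v) + y (se D v) - y (nw D v)"
      using y v by (auto simp: is_cycle_def algebra_simps)
    show "int_scale (face_boundary D cs (ne D v)) (y (nw D v))
        - int_scale (face_boundary D cs (se D v)) (y (sw D v))
        = (h (ne D v) + h (nw D v)) - (h (sw D v) + h (se D v))"
      using corner[of "(v, West)"] corner[of "(v, East)"] corner[of "(v, North)"]
        corner[of "(v, South)"] v
      unfolding face_boundary_def h_def F_def[symmetric]
      by (auto simp: int_scale_def yv)
  qed simp
  also have "\<dots> = 0"
    by (simp only: sum_subtractf sum_out[OF D] sum_in[OF D]) simp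
  finally show ?thesis .
qed


section \<open>Oriented parities\<close>

fun triangle_sign :: "quadrant \<Rightarrow> int" where
  "triangle_sign West = 1"
| "triangle_sign East = 1"
| "triangle_sign North = - 1"
| "triangle_sign South = - 1"

definition oriented_parity :: "vdiagram set \<Rightarrow> (vdiagram \<Rightarrow> nat \<Rightarrow> 'a::ab_group_add) \<Rightarrow> bool" where
  "oriented_parity L p \<longleftrightarrow>
     (\<forall>D \<in> L. \<forall>D' f. move D D' f \<longrightarrow> (\<forall>v v'. f v = Some v' \<longrightarrow> p D v = p D' v')) \<and>
     (\<forall>D \<in> L. \<forall>D' v. R1_dec v D D' \<longrightarrow> p D v = 0) \<and>
     (\<forall>D \<in> L. \<forall>D' v1 v2. R2_dec v1 v2 D D' \<longrightarrow> p D v1 + p D v2 = 0) \<and>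
     (\<forall>D \<in> L. \<forall>D' \<Delta>. R3 \<Delta> D D' \<longrightarrow>
        (\<Sum>(v, q) \<in> set \<Delta>. int_scale (triangle_sign q) (p D v)) = 0)"

text \<open>
  Two disjoint subsegments of an arc of \<open>D\<close>, running side by side in the same direction, undergo an
  increasing second Reidemeister move. Both pass first through the new crossing \<open>u\<close>, where they enter
  the bigon, and then through the new crossing \<open>w\<close>. The choice of \<open>b\<close> says which of them is the upper
  one; given \<open>b\<close>, the choice of \<open>s\<close> says on which side of each other they run.
\<close>

definition double_arc :: "vdiagram \<Rightarrow> arc \<Rightarrow> nat \<Rightarrow> nat \<Rightarrow> bool \<Rightarrow> bool \<Rightarrow> vdiagram" where
  "double_arc D a u w b s = (case a of (i, k) \<Rightarrow>
     \<lparr>comps = (comps D)[i := take (Suc k) (comps D ! i)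
                @ [(u, b), (w, b), (u, \<not> b), (w, \<not> b)] @ drop (Suc k) (comps D ! i)],
      positive = (positive D)(u := s, w := \<not> s)\<rparr>)"

lemma arc_from_eqI: "diagram D \<Longrightarrow> a \<in> open_arcs D \<Longrightarrow> arc_from D (tail D a) = a"
  using bij_betw_tail[of D] unfolding arc_from_def
  by (intro the_equality) (auto simp: bij_betw_def inj_on_def)

lemma arc_to_eqI: "diagram D \<Longrightarrow> a \<in> open_arcs D \<Longrightarrow> arc_to D (head D a) = a"
  using bij_betw_head[of D] unfolding arc_to_def
  by (intro the_equality) (auto simp: bij_betw_def inj_on_def)

lemma double_arc_R2:
  assumes D: "diagram D" and a: "a \<in> arcs D"
    and uw: "u \<noteq> w" "u \<notin> crossings D" "w \<notin> crossings D"
  shows "diagram (double_arc D a u w b s)"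
    and "R2_dec u w (double_arc D a u w b s) (D\<lparr>positive := (positive D)(u := s, w := \<not> s)\<rparr>)"
proof -
  obtain i k where ik: "a = (i, k)" "i < length (comps D)"
    using a by (auto simp: arcs_def)
  define W where "W = comps D ! i"
  define A where "A = take (Suc k) W"
  define B where "B = drop (Suc k) W"
  define P where "P = take i (comps D)"
  define Q where "Q = drop (Suc i) (comps D)"
  define N where "N = [(u, b), (w, b), (u, \<not> b), (w, \<not> b)]"
  define m where "m = length A"
  let ?D = "double_arc D a u w b s"
  have AB: "A @ B = comps D ! i" by (simp add: A_def B_def W_def)
  have c: "comps D = P @ (A @ B) # Q"
    unfolding AB P_def Q_def using ik(2) by (rule id_take_nth_drop)
  have lP: "length P = i" using ik(2) by (simp add: P_def)
  have c': "comps ?D = P @ (A @ N @ B) # Q"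
    using ik(2) by (simp add: double_arc_def ik(1) upd_conv_take_nth_drop P_def Q_def A_def B_def
        W_def N_def)
  have pos: "positive ?D = (positive D)(u := s, w := \<not> s)"
    by (simp add: double_arc_def ik(1))
  have fresh: "(u, d) \<notin> set (concat (comps D))" "(w, d) \<notin> set (concat (comps D))" for d
    using uw by (force simp: crossings_def simp del: set_concat)+
  have "set (concat (comps ?D)) = set (concat (comps D)) \<union> set N"
    by (auto simp: c c')
  then have sets: "x \<in> set (concat (comps ?D)) \<longleftrightarrow> x \<in> set (concat (comps D)) \<or> fst x \<in> {u, w}"
    for x by (cases x) (auto simp: N_def)
  have "distinct (concat (comps ?D))"
    using D fresh uw(1) unfolding diagram_def c c' by (auto simp: N_def)
  then show D': "diagram ?D"
    using D sets by (auto simp: diagram_def simp del: set_concat)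
  have lN: "length N = 4" by (simp add: N_def)
  have oa: "(i, m + t) \<in> open_arcs ?D" if "t < 4" for t
    using that by (simp add: open_arcs_def c' lP[symmetric] N_def m_def)
  have tl: "tail ?D (i, m + t) = N ! t" if "t < 4" for t
    using that by (simp add: tail_def c' lP[symmetric] lN m_def nth_append)
  have hd: "head ?D (i, m + t) = N ! Suc t" if "t < 3" for t
    using that by (simp add: head_def c' lP[symmetric] lN m_def nth_append)
  have f: "arc_from ?D (u, b) = (i, m + 0)" "arc_from ?D (u, \<not> b) = (i, m + 2)"
    using arc_from_eqI[OF D' oa[of 0]] arc_from_eqI[OF D' oa[of 2]] tl[of 0] tl[of 2]
    by (simp_all add: N_def)
  have t: "arc_to ?D (w, b) = (i, m + 0)" "arc_to ?D (w, \<not> b) = (i, m + 2)"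
    using arc_to_eqI[OF D' oa[of 0]] arc_to_eqI[OF D' oa[of 2]] hd[of 0] hd[of 2]
    by (simp_all add: N_def)
  have ft: "arc_from ?D (u, d) = arc_to ?D (w, d)" for d
    using f t by (cases d; cases b) auto
  have "u \<in> crossings ?D" "w \<in> crossings ?D"
    using sets[of "(u, b)"] sets[of "(w, b)"] unfolding crossings_def
    by (metis fst_conv image_eqI insertCI)+
  then have face: "face ?D [(u, North), (w, South)]"
    using uw(1) by (simp add: face_def ne_def nw_def sw_def se_def pos ft less_Suc_eq)
  have "set (sides ?D [(u, North), (w, South)]) = {arc_to ?D (w, s), arc_to ?D (w, \<not> s)}"
    using uw(1) by (simp add: sides_def ne_def sw_def pos ft)
  also have "\<dots> = {arc_to ?D (w, b), arc_to ?D (w, \<not> b)}"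
    by (cases "s = b") auto
  finally have sd: "set (sides ?D [(u, North), (w, South)]) = {(i, m + 0), (i, m + 2)}"
    by (simp only: t)
  have up: "\<exists>a \<in> {(i, m + 0), (i, m + 2)}. upper_side ?D a"
    using tl[of 0] tl[of 2] hd[of 0] hd[of 2] by (cases b) (auto simp: upper_side_def N_def)
  have low: "\<exists>a \<in> {(i, m + 0), (i, m + 2)}. lower_side ?D a"
    using tl[of 0] tl[of 2] hd[of 0] hd[of 2] by (cases b) (auto simp: lower_side_def N_def)
  have keep: "filter (\<lambda>x. fst x \<notin> {u, w}) xs = xs" if "set xs \<subseteq> set (concat (comps D))" for xs
    using that fresh by (force intro!: filter_True simp del: set_concat)
  have "map (filter (\<lambda>x. fst x \<notin> {u, w})) (comps ?D) = comps D"
  proof -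
    have "filter (\<lambda>x. fst x \<notin> {u, w}) A = A" "filter (\<lambda>x. fst x \<notin> {u, w}) B = B"
      by (rule keep; force simp: c)+
    moreover have "map (filter (\<lambda>x. fst x \<notin> {u, w})) P = P"
      "map (filter (\<lambda>x. fst x \<notin> {u, w})) Q = Q"
      by (rule map_idI, rule keep, force simp: c)+
    moreover have "filter (\<lambda>x. fst x \<notin> {u, w}) N = []" by (simp add: N_def)
    ultimately show ?thesis unfolding c c' by simp
  qed
  then have "remove {u, w} ?D = D\<lparr>positive := (positive D)(u := s, w := \<not> s)\<rparr>"
    using pos by (cases D) (simp add: remove_def double_arc_def ik(1))
  then show "R2_dec u w ?D (D\<lparr>positive := (positive D)(u := s, w := \<not> s)\<rparr>)"
    unfolding R2_dec_def using face sd up low uw(1) by auto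
qed

definition arc_value :: "(vdiagram \<Rightarrow> nat \<Rightarrow> 'a::ab_group_add) \<Rightarrow> vdiagram \<Rightarrow> arc \<Rightarrow> 'a" where
  "arc_value p D a = (THE x. \<exists>u w b s. u \<noteq> w \<and> u \<notin> crossings D \<and> w \<notin> crossings D \<and>
     x = p (double_arc D a u w b s) u)"

definition parity_cycle :: "(vdiagram \<Rightarrow> nat \<Rightarrow> 'a::ab_group_add) \<Rightarrow> vdiagram \<Rightarrow> arc \<Rightarrow> 'a" where
  "parity_cycle p D a = (if a \<in> arcs D then arc_value p D a else 0)"


section \<open>Paths in a diagram\<close>

text \<open>The path along the orientation from a passage \<open>x\<close> to another passage \<open>y\<close> of the same component.\<close>

definition path :: "vdiagram \<Rightarrow> passage \<Rightarrow> passage \<Rightarrow> arc list" where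
  "path D x y =
     (let (i, k) = arc_from D x; (j, l) = arc_from D y; n = length (comps D ! i)
      in map (\<lambda>t. (i, (k + t) mod n)) [0..<(l + n - k) mod n])"

definition self_crossing :: "vdiagram \<Rightarrow> nat \<Rightarrow> nat \<Rightarrow> bool" where
  "self_crossing D i v \<longleftrightarrow> (v, True) \<in> set (comps D ! i) \<and> (v, False) \<in> set (comps D ! i)"

definition left_half :: "vdiagram \<Rightarrow> nat \<Rightarrow> arc list" where
  "left_half D v = path D (v, \<not> positive D v) (v, positive D v)"

definition mixed_crossing :: "vdiagram \<Rightarrow> nat \<Rightarrow> nat \<Rightarrow> nat \<Rightarrow> bool" where
  "mixed_crossing D i j v \<longleftrightarrow>
     (\<exists>b. (v, b) \<in> set (comps D ! i) \<and> (v, \<not> b) \<in> set (comps D ! j))"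

text \<open>For a crossing \<open>v\<close> of the component \<open>i\<close> with a different component.\<close>

definition passage_in :: "vdiagram \<Rightarrow> nat \<Rightarrow> nat \<Rightarrow> passage" where
  "passage_in D i v = (THE x. x \<in> set (comps D ! i) \<and> fst x = v)"

definition component_path :: "vdiagram \<Rightarrow> nat \<Rightarrow> nat \<Rightarrow> nat \<Rightarrow> arc list" where
  "component_path D i v w = path D (passage_in D i v) (passage_in D i w)"

text \<open>\<open>goes_through \<gamma> a b\<close>: the closed walk \<open>\<gamma>\<close> passes from the arc \<open>a\<close> directly to the arc \<open>b\<close>.\<close>

definition goes_through :: "arc list \<Rightarrow> arc \<Rightarrow> arc \<Rightarrow> bool" where
  "goes_through \<gamma> a b \<longleftrightarrow> (\<exists>k < length \<gamma>. \<gamma> ! k = a \<and> \<gamma> ! (Suc k mod length \<gamma>) = b)"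

definition incidence_index :: "vdiagram \<Rightarrow> arc list \<Rightarrow> nat \<Rightarrow> int" where
  "incidence_index D \<gamma> v =
     (if goes_through \<gamma> (sw D v) (nw D v) then 1
      else if goes_through \<gamma> (se D v) (ne D v) then - 1
      else 0)"

end

theory Submission
  imports Defs
begin

text \<open>
  A parity can be measured by bigons. For two points \<open>x\<close>, \<open>z\<close> of \<open>D\<close> make a bigon of the
  parallel strands at \<open>x\<close> and \<open>z\<close> by R2, the strand at \<open>x\<close> coming from SW at the first
  crossing \<open>u\<close>; let \<open>h(x, z)\<close> be the value of \<open>p\<close> at \<open>u\<close>. Let \<open>k(t, z)\<close> be the corresponding value
  for antiparallel strands at \<open>t\<close> and \<open>z\<close>. If a strand at a third point \<open>t\<close> is pulled across the
  bigon of \<open>x\<close> and \<open>z\<close>, near \<open>u\<close>, the relation (P3+) of the resulting triangle says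
  \<open>h(x, z) = h(x, t) + k(t, z)\<close> (lemma \<open>third_strand\<close>).
  It implies that \<open>h\<close> does not depend on the choice of the upper strand, that it depends only on
  the arcs of \<open>x\<close> and \<open>z\<close>, also for two points of the same arc in either order, and that the
  increments \<open>h(x, b) - h(x, a) = k(a, b)\<close> do not depend on \<open>x\<close>. As a function of two arcs \<open>h\<close> is
  called \<open>linking\<close>; its diagonal is the parity cycle: \<open>\<delta>\<^sub>a = h(a, a)\<close>
  (lemma \<open>parity_cycle_eq_linking\<close>).

  At a crossing \<open>v\<close> there are bigons of two adjacent arcs one of whose crossings cancels with \<open>v\<close>.
  They give (lemma \<open>parity_linking\<close>)
  \<open>p(v) = h(SW, SE) = - h(NW, NE) = h(x, NW) - h(x, SW)\<close>.
  For fixed \<open>x\<close> and \<open>F(a) = h(x, a)\<close> it follows that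
  \<open>F(NE) - F(SW) = - \<delta>\<close> at NW and \<open>F(NW) - F(SE) = \<delta>\<close> at SW,
  and these are, up to a common sign, the terms that \<open>v\<close> contributes to the intersection numbers
  with \<open>\<delta>\<close>. So \<open>\<delta>\<close> has a potential. Let \<open>M\<close> be \<open>F(SW)\<close> at the passage of \<open>v\<close> from SW to NE, and \<open>F(NW)\<close> at the
  passage from SE to NW. Every arc \<open>a\<close> has the intersection number
  \<open>a \<cdot> \<delta> = M(tail of a) - M(head of a)\<close> (lemma \<open>intersection_single_arc\<close>),
  and \<open>p(v)\<close> is the difference of the values of \<open>M\<close> at the two passages of \<open>v\<close>. Along a path the
  intersection numbers telescope, and both formulas result from the values of \<open>M\<close> at the
  end points of the left half or of the two paths.
\<close>

section \<open>Moves within a virtual link\<close>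

lemma virtual_link_diagram:
  assumes "virtual_link L" "E \<in> L" shows "diagram E"
  using assms unfolding virtual_link_def by (auto elim!: quotientE)

lemma virtual_link_move_closed:
  assumes "virtual_link L" "E \<in> L" "move E E' f \<or> move E' E f"
  shows "E' \<in> L"
proof -
  let ?R = "\<lambda>D D'. \<exists>f. move D D' f"
  obtain X where L: "L = {D'. diagram X \<and> diagram D' \<and> equivclp ?R X D'}"
    using assms(1) unfolding virtual_link_def by (auto elim!: quotientE)
  have "equivclp ?R E E'"
    using assms(3) by blast
  then have "equivclp ?R X E'"
    using assms(2) unfolding L by (blast intro: equivclp_trans)
  moreover have "diagram E'"
    using assms(3) by (auto elim: move.cases)
  ultimately show ?thesis using assms(2) unfolding L by blast
qed

lemma concat_comps_remove:
  "concat (comps (remove S E)) = filter (\<lambda>x. fst x \<notin> S) (concat (comps E))"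
  by (simp add: remove_def filter_concat)

lemma diagram_remove: "diagram E \<Longrightarrow> diagram (remove S E)"
  unfolding diagram_def concat_comps_remove by auto

lemma crossings_remove: "crossings (remove S E) = crossings E - S"
  unfolding crossings_def concat_comps_remove by force

section \<open>Bigons and triangles in the words of a diagram\<close>

definition follows :: "vdiagram \<Rightarrow> passage \<Rightarrow> passage \<Rightarrow> bool" where
  "follows E x y \<longleftrightarrow> (\<exists>a \<in> open_arcs E. tail E a = x \<and> head E a = y)"

lemma followsD:
  assumes "diagram E" "follows E x y"
  shows "arc_from E x = arc_to E y" "tail E (arc_to E y) = x" "head E (arc_to E y) = y"
    "fst x \<in> crossings E" "fst y \<in> crossings E"
proof -
  obtain a where a: "a \<in> open_arcs E" "tail E a = x" "head E a = y"
    using assms(2) by (auto simp: follows_def)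
  show "arc_from E x = arc_to E y" "tail E (arc_to E y) = x" "head E (arc_to E y) = y"
    using arc_from_eqI[OF assms(1) a(1)] arc_to_eqI[OF assms(1) a(1)] a by auto
  have "x \<in> set (concat (comps E))" "y \<in> set (concat (comps E))"
    using a bij_betwE[OF bij_betw_tail[OF assms(1)]] bij_betwE[OF bij_betw_head[OF assms(1)]]
    by blast+
  then show "fst x \<in> crossings E" "fst y \<in> crossings E"
    unfolding crossings_def by blast+
qed

text \<open>
  Two strands of which one is upper at both \<open>u\<close> and \<open>w\<close>, and which have no crossings between these
  two. The opposite signs say that the strands meet from opposite sides at \<open>u\<close> and \<open>w\<close>, so
  that they bound a disc of \<open>AD(E)\<close>. In the first alternative they run in the same direction, in the
  second one in opposite directions.
\<close>

definition bigon :: "vdiagram \<Rightarrow> nat \<Rightarrow> nat \<Rightarrow> bool" where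
  "bigon E u w \<longleftrightarrow> u \<noteq> w \<and> positive E u \<noteq> positive E w \<and>
     (\<exists>b. follows E (u, b) (w, b) \<and> (follows E (u, \<not> b) (w, \<not> b) \<or> follows E (w, \<not> b) (u, \<not> b)))"

text \<open>
  Parallel strands bound the bigon north of \<open>u\<close> and south of \<open>w\<close>; antiparallel strands bound it east
  of both crossings or west of both, according to which of the strands comes from SW at \<open>u\<close>.
\<close>

lemma bigon_R2_dec:
  assumes E: "diagram E" and uw: "bigon E u w"
  shows "R2_dec u w E (remove {u, w} E)"
proof -
  obtain b where ne: "u \<noteq> w" and pos: "positive E w = (\<not> positive E u)"
    and f: "follows E (u, b) (w, b)"
    and g: "follows E (u, \<not> b) (w, \<not> b) \<or> follows E (w, \<not> b) (u, \<not> b)"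
    using uw unfolding bigon_def by auto
  note f = followsD[OF E f]
  have cr: "u \<in> crossings E" "w \<in> crossings E" using f(4,5) by auto
  have "\<exists>q1 q2. face E [(u, q1), (w, q2)] \<and>
      (\<exists>a \<in> set (sides E [(u, q1), (w, q2)]). upper_side E a) \<and>
      (\<exists>a \<in> set (sides E [(u, q1), (w, q2)]). lower_side E a)"
    using g
  proof
    assume "follows E (u, \<not> b) (w, \<not> b)"
    note g = followsD[OF E this]
    have ft: "arc_from E (u, d) = arc_to E (w, d)" for d
      using f(1) g(1) by (cases d; cases b) auto
    have th: "tail E (arc_to E (w, d)) = (u, d)" "head E (arc_to E (w, d)) = (w, d)" for d
      using f(2,3) g(2,3) by (cases d; cases b; simp)+
    have "face E [(u, North), (w, South)]"
      using ne cr by (simp add: face_def ne_def nw_def sw_def se_def pos ft less_Suc_eq)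
    moreover have "set (sides E [(u, North), (w, South)])
        = {arc_to E (w, positive E u), arc_to E (w, \<not> positive E u)}"
      by (simp add: sides_def ne_def sw_def pos ft)
    ultimately show ?thesis
      by (intro exI[of _ North] exI[of _ South])
        (cases "positive E u"; simp add: upper_side_def lower_side_def th)
  next
    assume "follows E (w, \<not> b) (u, \<not> b)"
    note g = followsD[OF E this]
    define q where "q = (if b = positive E u then East else West)"
    have "face E [(u, q), (w, q)] \<and>
        set (sides E [(u, q), (w, q)]) = {arc_to E (w, b), arc_to E (u, \<not> b)}"
    proof (cases "b = positive E u")
      case True
      then have "b = positive E u" "positive E w = (\<not> b)" by (auto simp: pos)
      then show ?thesis
        using ne cr f(1) g(1)
        by (auto simp add: q_def face_def sides_def ne_def nw_def sw_def se_def less_Suc_eq)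
    next
      case False
      then have "positive E u = (\<not> b)" "positive E w = b" by (auto simp: pos)
      then show ?thesis
        using ne cr f(1) g(1)
        by (auto simp add: q_def face_def sides_def ne_def nw_def sw_def se_def less_Suc_eq)
    qed
    then show ?thesis
      using f(2,3) g(2,3)
      by (intro exI[of _ q]) (cases b; simp add: upper_side_def lower_side_def)
  qed
  then show ?thesis using ne by (auto simp: R2_dec_def)
qed

text \<open>
  The strand from \<open>A\<close> to \<open>B\<close> passes over or under the two
  other strands, which meet at \<open>u\<close> after crossing it from its right to its left. The triangle
  lies north of \<open>A\<close>, west of \<open>B\<close> and south of \<open>u\<close>.
\<close>

lemma oriented_parity_triangle:
  fixes p :: "vdiagram \<Rightarrow> nat \<Rightarrow> 'a::ab_group_add"
  assumes p: "oriented_parity L p" and E: "E \<in> L" "diagram E"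
    and dist: "distinct [A, B, u]"
    and AB: "follows E (A, c) (B, c)" and Bu: "follows E (B, \<not> c) (u, \<not> b)"
    and Au: "follows E (A, \<not> c) (u, b)"
    and pos: "positive E A = c" "positive E B = c" "positive E u = b"
  shows "p E u = p E B - p E A"
proof -
  let ?T = "[(A, North), (B, West), (u, South)]"
  note AB = followsD[OF E(2) AB] and Bu = followsD[OF E(2) Bu] and Au = followsD[OF E(2) Au]
  have "face E ?T"
    using dist AB(1,4,5) Bu(1,5) Au(1) pos
    by (auto simp: face_def ne_def nw_def sw_def se_def less_Suc_eq)
  moreover have sides: "set (sides E ?T) = {arc_to E (B, c), arc_to E (u, \<not> b), arc_to E (u, b)}"
    using AB(1) Bu(1) pos by (auto simp: sides_def ne_def nw_def sw_def se_def)
  moreover have "\<exists>a \<in> set (sides E ?T). upper_side E a" "\<exists>a \<in> set (sides E ?T). lower_side E a"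
    unfolding sides using AB(2,3) Bu(2,3) Au(2,3)
    by (cases c; cases b; simp add: upper_side_def lower_side_def)+
  ultimately have "\<exists>D'. R3 ?T E D'"
    using dist by (simp add: R3_def)
  then have "(\<Sum>(v, q) \<in> set ?T. int_scale (triangle_sign q) (p E v)) = 0"
    using p E(1) unfolding oriented_parity_def by blast
  then show ?thesis
    using dist by (simp add: int_scale_def algebra_simps)
qed

section \<open>Second Reidemeister moves and parities\<close>

locale parity_on_link =
  fixes L :: "vdiagram set" and p :: "vdiagram \<Rightarrow> nat \<Rightarrow> 'a::ab_group_add"
  assumes virtual_link: "virtual_link L" and oriented_parity: "oriented_parity L p"
begin

lemma parity_move:
  assumes "E \<in> L" "move E E' f" "f v = Some v'" shows "p E v = p E' v'"
  using oriented_parity assms unfolding oriented_parity_def by blast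

lemma bigon_in_link:
  assumes E: "diagram E" and uw: "bigon E u w"
  shows "E \<in> L \<longleftrightarrow> remove {u, w} E \<in> L"
    and "E \<in> L \<Longrightarrow> p E u + p E w = 0"
    and "E \<in> L \<Longrightarrow> v \<in> crossings E \<Longrightarrow> v \<notin> {u, w} \<Longrightarrow> p (remove {u, w} E) v = p E v"
proof -
  let ?E' = "remove {u, w} E"
  let ?f = "\<lambda>v. if v \<in> crossings E \<inter> crossings ?E' then Some v else None"
  note R2 = bigon_R2_dec[OF E uw]
  have mv: "move E ?E' ?f"
    using R2 E diagram_remove[OF E] by (intro move.reidemeister) (auto simp: reidemeister_def)
  show "E \<in> L \<longleftrightarrow> ?E' \<in> L"
    using virtual_link_move_closed[OF virtual_link] mv by blast
  show "p E u + p E w = 0" if "E \<in> L"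
    using oriented_parity R2 that unfolding oriented_parity_def by blast
  show "p ?E' v = p E v" if "E \<in> L" "v \<in> crossings E" "v \<notin> {u, w}"
    by (rule parity_move[OF that(1) mv, symmetric]) (use that in \<open>simp add: crossings_remove\<close>)
qed

text \<open>
  Diagrams that differ only in the signs of numbers that are not crossings are related by the
  isotopy with the identity on crossings.
\<close>

lemma sign_irrelevant:
  assumes E: "diagram E" and c: "comps E' = comps E"
    and s: "\<And>v. v \<in> crossings E \<Longrightarrow> positive E' v = positive E v"
  shows "E' \<in> L \<longleftrightarrow> E \<in> L" and "E \<in> L \<Longrightarrow> v \<in> crossings E \<Longrightarrow> p E' v = p E v"
proof -
  have cr: "crossings E' = crossings E" by (simp add: crossings_def c)
  have "\<exists>\<pi>. \<pi> permutes {..<length (comps E)} \<and>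
     (\<forall>i < length (comps E). \<exists>r. comps E ! \<pi> i = rotate r (map (map_prod id id) (comps E ! i)))"
    by (rule exI[of _ id]) (auto simp: permutes_id map_prod.id intro!: exI[of _ 0])
  then have "detour_iso E E' id"
    using s by (simp add: detour_iso_def cr c bij_betw_def)
  then have mv: "move E E' (\<lambda>v. if v \<in> crossings E then Some (id v) else None)"
    using E c by (intro move.iso[where g=id]) (simp_all add: diagram_def del: set_concat)
  show "E' \<in> L \<longleftrightarrow> E \<in> L"
    using virtual_link_move_closed[OF virtual_link] mv by blast
  show "p E' v = p E v" if "E \<in> L" "v \<in> crossings E"
    by (rule parity_move[OF that(1) mv, symmetric]) (use that in simp)
qed

end

section \<open>Inserting words at points of a diagram\<close>

text \<open>
  Three slots on every arc are enough for the arguments below: they provide a point away from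
  any two given ones, and two points of the same arc in either order, even on a component without
  crossings.
\<close>

datatype slot = Front | Middle | Back

type_synonym point = "arc \<times> slot"

definition points :: "vdiagram \<Rightarrow> point set" where
  "points D = arcs D \<times> UNIV"

definition arc_word :: "(point \<Rightarrow> passage list) \<Rightarrow> arc \<Rightarrow> passage list" where
  "arc_word \<tau> a = \<tau> (a, Front) @ \<tau> (a, Middle) @ \<tau> (a, Back)"

definition fill_word :: "vdiagram \<Rightarrow> (point \<Rightarrow> passage list) \<Rightarrow> nat \<Rightarrow> passage list" where
  "fill_word D \<tau> i =
     (if comps D ! i = [] then arc_word \<tau> (i, 0)
      else concat (map (\<lambda>k. comps D ! i ! k # arc_word \<tau> (i, k)) [0..<length (comps D ! i)]))"

text \<open>
  The diagram \<open>D\<close> with the word \<open>\<tau> q\<close> inserted at each point \<open>q\<close>; \<open>s\<close> gives the signs of the new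
  crossings. Points with the empty word leave no trace, so a diagram with words at three points
  and the diagrams where some of the words are removed again are fillings of the same \<open>D\<close>.
\<close>

definition fill :: "vdiagram \<Rightarrow> (point \<Rightarrow> passage list) \<Rightarrow> (nat \<Rightarrow> bool) \<Rightarrow> vdiagram" where
  "fill D \<tau> s = \<lparr>comps = map (fill_word D \<tau>) [0..<length (comps D)],
     positive = (\<lambda>v. if v \<in> crossings D then positive D v else s v)\<rparr>"

lemma UNIV_slot: "(UNIV :: slot set) = {Front, Middle, Back}"
  using slot.exhaust by auto

lemma finite_points: "finite (points D)"
proof -
  have "arcs D = (SIGMA i:{..<length (comps D)}. {..<max 1 (length (comps D ! i))})"
    by (auto simp: arcs_def)
  then show ?thesis by (simp add: points_def UNIV_slot)
qed

lemma mset_concat_upt: "mset (concat (map f [0..<n])) = (\<Sum>k<n. mset (f k))"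
  by (induction n) (auto simp: add.commute)

lemma mset_arc_word: "mset (arc_word \<tau> a) = (\<Sum>c\<in>UNIV. mset (\<tau> (a, c)))"
  by (simp add: arc_word_def UNIV_slot)

lemma mset_fill_word:
  "mset (fill_word D \<tau> i)
    = mset (comps D ! i) + (\<Sum>k<max 1 (length (comps D ! i)). mset (arc_word \<tau> (i, k)))"
proof (cases "comps D ! i = []")
  case False
  have "mset (comps D ! i) = (\<Sum>k<length (comps D ! i). {#comps D ! i ! k#})"
    using mset_concat_upt[of "\<lambda>k. [comps D ! i ! k]" "length (comps D ! i)"]
    by (simp add: concat_map_singleton map_nth)
  moreover have "max 1 (length (comps D ! i)) = length (comps D ! i)"
    using False by (cases "comps D ! i") auto
  ultimately show ?thesis
    using False by (simp add: fill_word_def mset_concat_upt sum.distrib flip: add_mset_add_single)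
      (simp add: sum.distrib[symmetric])
qed (simp add: fill_word_def)

lemma mset_fill:
  "mset (concat (comps (fill D \<tau> s)))
    = mset (concat (comps D)) + (\<Sum>q\<in>points D. mset (\<tau> q))"
proof -
  let ?n = "length (comps D)" and ?m = "\<lambda>i. max 1 (length (comps D ! i))"
  have arcs: "arcs D = (SIGMA i:{..<?n}. {..<?m i})"
    by (auto simp: arcs_def)
  have "(\<Sum>q\<in>points D. mset (\<tau> q)) = (\<Sum>a\<in>arcs D. mset (arc_word \<tau> a))"
    unfolding points_def mset_arc_word by (simp add: sum.cartesian_product)
  also have "\<dots> = (\<Sum>i<?n. \<Sum>k<?m i. mset (arc_word \<tau> (i, k)))"
    unfolding arcs by (simp add: sum.Sigma)
  finally have "mset (concat (comps (fill D \<tau> s)))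
      = (\<Sum>i<?n. mset (comps D ! i)) + (\<Sum>q\<in>points D. mset (\<tau> q))"
    by (simp add: fill_def mset_concat_upt mset_fill_word sum.distrib)
  moreover have "mset (concat (comps D)) = (\<Sum>i<?n. mset (comps D ! i))"
    using mset_concat_upt[of "\<lambda>i. comps D ! i" ?n] by (simp add: map_nth)
  ultimately show ?thesis by simp
qed

lemma set_fill:
  "set (concat (comps (fill D \<tau> s))) = set (concat (comps D)) \<union> (\<Union>q\<in>points D. set (\<tau> q))"
proof -
  have "set (concat (comps (fill D \<tau> s))) = set_mset (mset (concat (comps (fill D \<tau> s))))"
    by (simp only: set_mset_mset)
  also have "\<dots> = set (concat (comps D)) \<union> (\<Union>q\<in>points D. set (\<tau> q))"
    unfolding mset_fill using finite_points by (simp add: set_mset_sum del: set_concat)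
  finally show ?thesis .
qed

lemma crossings_fill:
  "crossings (fill D \<tau> s) = crossings D \<union> (\<Union>q\<in>points D. fst ` set (\<tau> q))"
  unfolding crossings_def set_fill by blast

lemma positive_fill: "positive (fill D \<tau> s) v = (if v \<in> crossings D then positive D v else s v)"
  by (simp add: fill_def)

lemma concat_filter_upt:
  "filter P (concat (map f xs)) = concat (map (\<lambda>k. filter P (f k)) xs)"
  by (induction xs) auto

lemma remove_fill:
  assumes "S \<inter> crossings D = {}"
  shows "remove S (fill D \<tau> s) = fill D (\<lambda>q. filter (\<lambda>x. fst x \<notin> S) (\<tau> q)) s"
proof -
  have "filter (\<lambda>x. fst x \<notin> S) (fill_word D \<tau> i)
      = fill_word D (\<lambda>q. filter (\<lambda>x. fst x \<notin> S) (\<tau> q)) i" if "i < length (comps D)" for i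
  proof -
    have keep: "fst (comps D ! i ! k) \<notin> S" if "k < length (comps D ! i)" for k
    proof -
      have "comps D ! i ! k \<in> set (concat (comps D))"
        using that \<open>i < length (comps D)\<close> by (auto intro!: bexI[of _ "comps D ! i"])
      then show ?thesis using assms unfolding crossings_def by blast
    qed
    have "map (\<lambda>k. filter (\<lambda>x. fst x \<notin> S) (comps D ! i ! k # arc_word \<tau> (i, k)))
            [0..<length (comps D ! i)]
        = map (\<lambda>k. comps D ! i ! k # arc_word (\<lambda>q. filter (\<lambda>x. fst x \<notin> S) (\<tau> q)) (i, k))
            [0..<length (comps D ! i)]"
      by (rule map_cong) (simp_all add: keep arc_word_def)
    then show ?thesis
      by (simp only: fill_word_def concat_filter_upt if_distrib[of "filter _"])
        (simp add: arc_word_def)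
  qed
  then show ?thesis by (simp add: remove_def fill_def)
qed

lemma comps_fill_empty: "comps (fill D (\<lambda>_. []) s) = comps D"
proof -
  have "fill_word D (\<lambda>_. []) i = comps D ! i" for i
    by (simp add: fill_word_def arc_word_def concat_map_singleton map_nth)
  then have "fill_word D (\<lambda>_. []) = (!) (comps D)" by blast
  then show ?thesis by (simp add: fill_def map_nth)
qed

definition consecutive :: "'a list \<Rightarrow> 'a \<Rightarrow> 'a \<Rightarrow> bool" where
  "consecutive xs x y \<longleftrightarrow> (\<exists>us vs. xs = us @ x # y # vs)"

lemma consecutive_Nil [simp]: "\<not> consecutive [] x y"
  by (simp add: consecutive_def)

lemma consecutive_Cons [simp]:
  "consecutive (z # zs) x y \<longleftrightarrow> (z = x \<and> zs \<noteq> [] \<and> hd zs = y) \<or> consecutive zs x y"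
proof
  assume "consecutive (z # zs) x y"
  then obtain us vs where "z # zs = us @ x # y # vs" by (auto simp: consecutive_def)
  then show "(z = x \<and> zs \<noteq> [] \<and> hd zs = y) \<or> consecutive zs x y"
    by (cases us) (auto simp: consecutive_def)
next
  assume "(z = x \<and> zs \<noteq> [] \<and> hd zs = y) \<or> consecutive zs x y"
  then show "consecutive (z # zs) x y"
  proof
    assume "z = x \<and> zs \<noteq> [] \<and> hd zs = y"
    then have "z # zs = [] @ x # y # List.tl zs" by (cases zs) auto
    then show ?thesis unfolding consecutive_def by blast
  next
    assume "consecutive zs x y"
    then obtain us vs where "zs = us @ x # y # vs" by (auto simp: consecutive_def)
    then have "z # zs = (z # us) @ x # y # vs" by simp
    then show ?thesis unfolding consecutive_def by blast
  qed
qed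

lemma consecutive_infix: "consecutive xs x y \<Longrightarrow> consecutive (us @ xs @ vs) x y"
  unfolding consecutive_def by (metis append.assoc append_Cons)

lemma consecutive_follows:
  assumes i: "i < length (comps E)" and c: "consecutive (comps E ! i @ [hd (comps E ! i)]) x y"
  shows "follows E x y"
proof -
  let ?W = "comps E ! i"
  obtain us vs where eq: "?W @ [hd ?W] = us @ x # y # vs"
    using c by (auto simp: consecutive_def)
  define k where "k = length us"
  have len: "length ?W + 1 = k + 2 + length vs"
    using arg_cong[OF eq, of length] by (simp add: k_def)
  have x: "(?W @ [hd ?W]) ! k = x" and y: "(?W @ [hd ?W]) ! Suc k = y"
    unfolding eq k_def by (simp_all add: nth_append)
  have k: "k < length ?W" using len by simp
  have W: "?W \<noteq> []" using k by auto
  have "?W ! (Suc k mod length ?W) = y"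
  proof (cases "Suc k < length ?W")
    case False
    then have "Suc k = length ?W" using k by simp
    then show ?thesis using y W by (simp add: nth_append hd_conv_nth)
  qed (use y in \<open>simp add: nth_append\<close>)
  moreover have "?W ! k = x" using x k by (simp add: nth_append)
  ultimately show ?thesis
    using i k unfolding follows_def open_arcs_def
    by (intro bexI[of _ "(i, k)"]) (auto simp: tail_def head_def)
qed

text \<open>
  The inserted word closes up with the ends of its arc, also where the arc runs over the end of the
  list that represents the cyclic word of the component.
\<close>

lemma fill_follows:
  assumes a: "a \<in> open_arcs D"
    and c: "consecutive (tail D a # arc_word \<tau> a @ [head D a]) x y"
  shows "follows (fill D \<tau> s) x y"
proof -
  obtain i k where ik: "a = (i, k)" "i < length (comps D)" "k < length (comps D ! i)"
    using a by (auto simp: open_arcs_def)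
  let ?W = "comps D ! i" and ?F = "comps (fill D \<tau> s) ! i"
  let ?n = "length ?W"
  define f where "f = (\<lambda>k. ?W ! k # arc_word \<tau> (i, k))"
  have F: "?F = concat (map f [0..<?n])"
    using ik by (auto simp: fill_def fill_word_def f_def)
  define R where "R = concat (map f [Suc k..<?n])"
  have "[0..<?n] = [0..<k] @ k # [Suc k..<?n]"
    using ik(3) upt_add_eq_append[of 0 k "?n - k"] by (simp add: upt_conv_Cons)
  then have F': "?F = concat (map f [0..<k]) @ f k @ R"
    unfolding F R_def by simp
  have "\<exists>vs. R @ [hd ?F] = head D a # vs"
  proof (cases "Suc k < ?n")
    case True
    then have "R = f (Suc k) @ concat (map f [Suc (Suc k)..<?n])"
      unfolding R_def by (simp add: upt_conv_Cons)
    then show ?thesis using True by (simp add: f_def head_def ik(1))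
  next
    case False
    then have "Suc k = ?n" using ik(3) by simp
    moreover have "hd ?F = ?W ! 0"
      unfolding F using ik(3) by (cases ?n) (simp_all add: f_def upt_conv_Cons del: upt_Suc)
    ultimately show ?thesis by (simp add: R_def head_def ik(1))
  qed
  then obtain vs where vs: "R @ [hd ?F] = head D a # vs" by blast
  have "?F @ [hd ?F] = concat (map f [0..<k]) @ f k @ R @ [hd ?F]"
    by (subst (1) F') simp
  also have "\<dots> = concat (map f [0..<k]) @ (tail D a # arc_word \<tau> a @ [head D a]) @ vs"
    unfolding vs by (simp add: f_def tail_def ik(1))
  finally have "consecutive (?F @ [hd ?F]) x y"
    using consecutive_infix[OF c] by simp
  then show ?thesis
    by (rule consecutive_follows[rotated]) (use ik in \<open>simp add: fill_def\<close>)
qed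

lemma fill_follows_point:
  assumes q: "q \<in> points D" and c: "consecutive (\<tau> q) x y"
  shows "follows (fill D \<tau> s) x y"
proof -
  obtain a c where ac: "q = (a, c)" "a \<in> arcs D" using q by (auto simp: points_def)
  have "\<exists>us vs. arc_word \<tau> a = us @ \<tau> q @ vs"
  proof (cases c)
    case Front
    then show ?thesis unfolding ac arc_word_def by (metis append_Nil)
  next
    case Middle
    then show ?thesis unfolding ac arc_word_def by blast
  next
    case Back
    then show ?thesis unfolding ac arc_word_def by (metis append.assoc append_Nil2)
  qed
  then obtain us vs where w: "arc_word \<tau> a = us @ \<tau> q @ vs" by blast
  show ?thesis
  proof (cases "a \<in> open_arcs D")
    case True
    show ?thesis
      by (rule fill_follows[OF True])
        (use consecutive_infix[OF c, of "tail D a # us" "vs @ [head D a]"] w in simp)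
  next
    case False
    obtain i k where ik: "a = (i, k)" by (cases a)
    then have i: "a = (i, 0)" "i < length (comps D)" "comps D ! i = []"
      using ac(2) False by (cases "comps D ! i"; auto simp: arcs_def open_arcs_def)+
    then have "comps (fill D \<tau> s) ! i = us @ \<tau> q @ vs"
      using w by (simp add: fill_def fill_word_def)
    then show ?thesis
      using consecutive_infix[OF c, of us "vs @ [hd (us @ \<tau> q @ vs)]"] i
      by (intro consecutive_follows[of i]) (simp_all add: fill_def)
  qed
qed

section \<open>Second Reidemeister moves between two points\<close>

abbreviation fill3 ::
    "vdiagram \<Rightarrow> point \<Rightarrow> point \<Rightarrow> point \<Rightarrow> (nat \<Rightarrow> bool) \<Rightarrow>
     passage list \<Rightarrow> passage list \<Rightarrow> passage list \<Rightarrow> vdiagram" where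
  "fill3 D x z t s X Z T \<equiv> fill D ((\<lambda>_. [])(x := X, z := Z, t := T)) s"

lemma diagram_fill3:
  assumes D: "diagram D" and pts: "{x, z, t} \<subseteq> points D" "distinct [x, z, t]"
    and dist: "distinct (X @ Z @ T)" and fresh: "fst ` set (X @ Z @ T) \<inter> crossings D = {}"
    and both: "\<And>v b. (v, b) \<in> set (X @ Z @ T) \<Longrightarrow> (v, \<not> b) \<in> set (X @ Z @ T)"
  shows "diagram (fill3 D x z t s X Z T)"
proof -
  let ?\<tau> = "(\<lambda>_. [])(x := X, z := Z, t := T)" and ?E = "fill3 D x z t s X Z T"
  have "(\<Sum>q\<in>points D. mset (?\<tau> q)) = (\<Sum>q\<in>{x, z, t}. mset (?\<tau> q))"
    using pts finite_points by (intro sum.mono_neutral_right) auto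
  also have "\<dots> = mset (X @ Z @ T)" using pts(2) by simp
  finally have ms: "mset (concat (comps ?E)) = mset (concat (comps D) @ X @ Z @ T)"
    by (simp add: mset_fill)
  have "set (concat (comps D)) \<inter> set (X @ Z @ T) = {}"
    using fresh unfolding crossings_def by blast
  then have "distinct (concat (comps D) @ X @ Z @ T)"
    using D dist unfolding diagram_def distinct_append by blast
  then have "distinct (concat (comps ?E))"
    using mset_eq_imp_distinct_iff[OF ms] by blast
  moreover have "set (concat (comps ?E)) = set (concat (comps D)) \<union> set (X @ Z @ T)"
    using mset_eq_setD[OF ms] by simp
  ultimately show ?thesis
    using D both unfolding diagram_def by blast
qed

lemma bigon_fill:
  assumes "q \<in> points D" "q' \<in> points D"
    and "consecutive (\<tau> q) (u, b) (w, b)"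
    and "consecutive (\<tau> q') (u, \<not> b) (w, \<not> b) \<or> consecutive (\<tau> q') (w, \<not> b) (u, \<not> b)"
    and "u \<noteq> w" "u \<notin> crossings D" "w \<notin> crossings D" "s u \<noteq> s w"
  shows "bigon (fill D \<tau> s) u w"
proof -
  have "follows (fill D \<tau> s) (u, b) (w, b)"
    by (rule fill_follows_point) fact+
  moreover have "follows (fill D \<tau> s) (u, \<not> b) (w, \<not> b) \<or> follows (fill D \<tau> s) (w, \<not> b) (u, \<not> b)"
    using assms(4) fill_follows_point[OF assms(2)] by blast
  ultimately show ?thesis
    unfolding bigon_def positive_fill using assms(5-8) by auto
qed

text \<open>
  The increasing R2 between the strands at \<open>x\<close> and \<open>z\<close>, in the same or in opposite directions. The
  strand at \<open>x\<close> passes first through \<open>u\<close>, and the sign of \<open>u\<close> is such that it enters \<open>u\<close> from SW. It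
  is the upper one if \<open>b\<close> holds.
\<close>

definition R2_fill ::
    "vdiagram \<Rightarrow> bool \<Rightarrow> bool \<Rightarrow> nat \<Rightarrow> nat \<Rightarrow> point \<Rightarrow> point \<Rightarrow> vdiagram" where
  "R2_fill D par b u w x z =
     fill D ((\<lambda>_. [])(x := [(u, b), (w, b)],
         z := if par then [(u, \<not> b), (w, \<not> b)] else [(w, \<not> b), (u, \<not> b)]))
       (\<lambda>v. (v = u) = b)"

locale parity_on_diagram = parity_on_link L p
    for L :: "vdiagram set" and p :: "vdiagram \<Rightarrow> nat \<Rightarrow> 'a::ab_group_add" +
  fixes D :: vdiagram
  assumes in_link: "D \<in> L"
begin

lemma diagram: "diagram D"
  using virtual_link_diagram[OF virtual_link in_link] .

lemma fresh_crossings: "\<exists>us. length us = n \<and> distinct us \<and> set us \<inter> (crossings D \<union> set vs) = {}"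
proof -
  have "infinite (UNIV - (crossings D \<union> set vs))"
    by (intro Diff_infinite_finite) (simp_all add: crossings_def)
  then obtain S where S: "finite S" "card S = n" "S \<subseteq> UNIV - (crossings D \<union> set vs)"
    by (meson infinite_arbitrarily_large)
  obtain us where us: "set us = S" "distinct us" using finite_distinct_list[OF S(1)] by blast
  have "length us = n" using distinct_card[OF us(2)] us(1) S(2) by simp
  then show ?thesis using us S(3) by blast
qed

lemma fill_empty:
  shows "fill D (\<lambda>_. []) s \<in> L"
    and "v \<in> crossings D \<Longrightarrow> p (fill D (\<lambda>_. []) s) v = p D v"
proof -
  note * = sign_irrelevant[OF diagram comps_fill_empty[of D s]]
  show "fill D (\<lambda>_. []) s \<in> L"
    using * (1) in_link by (simp add: positive_fill)
  show "p (fill D (\<lambda>_. []) s) v = p D v" if "v \<in> crossings D"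
    by (rule * (2)) (simp_all add: positive_fill in_link that)
qed

lemma fill_sign_cong:
  assumes "diagram (fill D \<tau> s)"
    and "\<forall>q \<in> points D. \<forall>y \<in> set (\<tau> q). s' (fst y) = s (fst y)"
  shows "fill D \<tau> s' \<in> L \<longleftrightarrow> fill D \<tau> s \<in> L"
    and "fill D \<tau> s \<in> L \<Longrightarrow> v \<in> crossings (fill D \<tau> s) \<Longrightarrow> p (fill D \<tau> s') v = p (fill D \<tau> s) v"
proof -
  have c: "comps (fill D \<tau> s') = comps (fill D \<tau> s)" by (simp add: fill_def)
  have s: "positive (fill D \<tau> s') v = positive (fill D \<tau> s) v" if "v \<in> crossings (fill D \<tau> s)" for v
    using that assms(2) unfolding crossings_fill by (auto simp: positive_fill)
  show "fill D \<tau> s' \<in> L \<longleftrightarrow> fill D \<tau> s \<in> L"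
    using sign_irrelevant(1)[OF assms(1) c] s by blast
  show "fill D \<tau> s \<in> L \<Longrightarrow> v \<in> crossings (fill D \<tau> s) \<Longrightarrow> p (fill D \<tau> s') v = p (fill D \<tau> s) v"
    using sign_irrelevant(2)[OF assms(1) c] s by blast
qed

text \<open>
  The decreasing R2 inside a diagram with words at three points: it stays among such diagrams,
  so that several bigons can be removed in any order.
\<close>

lemma fill3_bigon:
  fixes x z t :: point and s :: "nat \<Rightarrow> bool"
  defines "E \<equiv> \<lambda>X Z T. fill3 D x z t s X Z T"
  assumes pts: "{x, z, t} \<subseteq> points D" "distinct [x, z, t]"
    and E: "diagram (E X Z T)"
    and uw: "u \<noteq> w" "u \<notin> crossings D" "w \<notin> crossings D" "s u \<noteq> s w"
    and b: "\<exists>V \<in> {X, Z, T}. consecutive V (u, b) (w, b)"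
    and nb: "\<exists>V \<in> {X, Z, T}. consecutive V (u, \<not> b) (w, \<not> b) \<or> consecutive V (w, \<not> b) (u, \<not> b)"
    and rest: "filter (\<lambda>y. fst y \<notin> {u, w}) X = X'" "filter (\<lambda>y. fst y \<notin> {u, w}) Z = Z'"
      "filter (\<lambda>y. fst y \<notin> {u, w}) T = T'"
  shows "diagram (E X' Z' T') \<and> (E X' Z' T' \<in> L \<longleftrightarrow> E X Z T \<in> L) \<and>
    (E X Z T \<in> L \<longrightarrow> p (E X Z T) w = - p (E X Z T) u \<and>
      (\<forall>v \<in> crossings D \<union> fst ` set (X @ Z @ T) - {u, w}. p (E X Z T) v = p (E X' Z' T') v))"
proof -
  let ?\<tau> = "(\<lambda>_. [])(x := X, z := Z, t := T)"
  have at: "\<exists>q \<in> points D. ?\<tau> q = V" if "V \<in> {X, Z, T}" for V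
    using that pts by auto
  have bg: "bigon (E X Z T) u w"
    using at b nb uw bigon_fill[of _ D _ ?\<tau> u b w s] unfolding E_def by metis
  have rm: "remove {u, w} (E X Z T) = E X' Z' T'"
  proof -
    have "remove {u, w} (E X Z T) = fill D (\<lambda>q. filter (\<lambda>y. fst y \<notin> {u, w}) (?\<tau> q)) s"
      unfolding E_def using uw by (intro remove_fill) auto
    moreover have "(\<lambda>q. filter (\<lambda>y. fst y \<notin> {u, w}) (?\<tau> q)) = (\<lambda>_. [])(x := X', z := Z', t := T')"
      using rest by auto
    ultimately show ?thesis unfolding E_def by (simp only:)
  qed
  have cr: "crossings D \<union> fst ` set (X @ Z @ T) \<subseteq> crossings (E X Z T)"
  proof -
    have "fst ` set V \<subseteq> crossings (E X Z T)" if "V \<in> {X, Z, T}" for V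
      using at[OF that] unfolding E_def crossings_fill by blast
    moreover have "crossings D \<subseteq> crossings (E X Z T)"
      unfolding E_def crossings_fill by blast
    ultimately show ?thesis by (simp add: image_Un)
  qed
  have "p (E X Z T) w = - p (E X Z T) u" if "E X Z T \<in> L"
    using bigon_in_link(2)[OF E bg that] by (metis add_eq_0_iff)
  moreover have "p (E X Z T) v = p (E X' Z' T') v"
    if "E X Z T \<in> L" "v \<in> crossings D \<union> fst ` set (X @ Z @ T) - {u, w}" for v
  proof -
    have "v \<in> crossings (E X Z T)" "v \<notin> {u, w}" using that(2) cr by blast+
    from bigon_in_link(3)[OF E bg that(1) this] show ?thesis by (simp only: rm)
  qed
  ultimately show ?thesis
    using diagram_remove[OF E, of "{u, w}"] bigon_in_link(1)[OF E bg] unfolding rm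
    by (intro conjI impI ballI) simp_all
qed

lemma fill3_sign_cong:
  assumes pts: "{x, z, t} \<subseteq> points D" "distinct [x, z, t]"
    and E: "diagram (fill3 D x z t s X Z T)"
    and s: "\<forall>y \<in> set (X @ Z @ T). s' (fst y) = s (fst y)"
    and v: "v \<in> fst ` set (X @ Z @ T)"
  shows "fill3 D x z t s' X Z T \<in> L \<longleftrightarrow> fill3 D x z t s X Z T \<in> L"
    and "fill3 D x z t s X Z T \<in> L \<Longrightarrow> p (fill3 D x z t s' X Z T) v = p (fill3 D x z t s X Z T) v"
proof -
  let ?\<tau> = "(\<lambda>_. [])(x := X, z := Z, t := T)"
  have s': "\<forall>q \<in> points D. \<forall>y \<in> set (?\<tau> q). s' (fst y) = s (fst y)"
    using s by auto
  have at: "\<exists>q \<in> points D. ?\<tau> q = V" if "V \<in> {X, Z, T}" for V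
    using that pts by auto
  have "fst ` set V \<subseteq> crossings (fill3 D x z t s X Z T)" if "V \<in> {X, Z, T}" for V
    using at[OF that] unfolding crossings_fill by blast
  then have v: "v \<in> crossings (fill3 D x z t s X Z T)"
    using v by (auto simp only: set_append image_Un)
  show "fill3 D x z t s' X Z T \<in> L \<longleftrightarrow> fill3 D x z t s X Z T \<in> L"
    and "fill3 D x z t s X Z T \<in> L \<Longrightarrow> p (fill3 D x z t s' X Z T) v = p (fill3 D x z t s X Z T) v"
    using fill_sign_cong(1)[OF E s'] fill_sign_cong(2)[OF E s' _ v] by blast+
qed

text \<open>
  Any two points leave room for a third strand, even if \<open>x\<close> and \<open>z\<close> share the only arc of \<open>D\<close>.
\<close>

lemma third_point:
  assumes "x \<in> points D"
  obtains t where "t \<in> points D" "t \<noteq> x" "t \<noteq> z"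
proof -
  have "\<exists>c. (fst x, c) \<noteq> x \<and> (fst x, c) \<noteq> z"
    by (cases x; cases z; cases "snd x"; cases "snd z") auto
  then obtain c where c: "(fst x, c) \<noteq> x" "(fst x, c) \<noteq> z" by blast
  have "(fst x, c) \<in> points D" using assms by (auto simp: points_def)
  then show ?thesis using that c by blast
qed

lemma R2_fill_facts:
  assumes pts: "x \<in> points D" "z \<in> points D" "x \<noteq> z"
    and uw: "u \<noteq> w" "u \<notin> crossings D" "w \<notin> crossings D"
  shows "diagram (R2_fill D par b u w x z)" and "R2_fill D par b u w x z \<in> L"
    and "p (R2_fill D par b u w x z) w = - p (R2_fill D par b u w x z) u"
    and "v \<in> crossings D \<Longrightarrow> p (R2_fill D par b u w x z) v = p D v"
proof -
  let ?s = "\<lambda>v. (v = u) = b" and ?E = "R2_fill D par b u w x z"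
  let ?X = "[(u, b), (w, b)]"
  define Z where "Z = (if par then [(u, \<not> b), (w, \<not> b)] else [(w, \<not> b), (u, \<not> b)])"
  obtain t where t: "t \<in> points D" "t \<noteq> x" "t \<noteq> z" using third_point[OF pts(1)] .
  have "(\<lambda>_. [])(x := ?X, z := Z) = (\<lambda>_. [])(x := ?X, z := Z, t := [])"
    using t by auto
  then have E: "fill3 D x z t ?s ?X Z [] = ?E"
    by (simp add: R2_fill_def Z_def)
  show dg: "diagram ?E"
    unfolding E[symmetric]
    by (rule diagram_fill3) (use diagram pts t uw in \<open>auto simp: Z_def split: if_splits\<close>)
  have pts': "{x, z, t} \<subseteq> points D" "distinct [x, z, t]" using pts t by auto
  have b: "\<exists>V \<in> {?X, Z, []}. consecutive V (u, b) (w, b)" by simp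
  have nb: "\<exists>V \<in> {?X, Z, []}. consecutive V (u, \<not> b) (w, \<not> b) \<or> consecutive V (w, \<not> b) (u, \<not> b)"
    by (simp add: Z_def)
  have F: "filter (\<lambda>y. fst y \<notin> {u, w}) ?X = []" "filter (\<lambda>y. fst y \<notin> {u, w}) Z = []"
    "filter (\<lambda>y. fst y \<notin> {u, w}) [] = []"
    by (simp_all add: Z_def)
  have e: "(\<lambda>_. [])(x := [], z := [], t := []) = (\<lambda>_. [])" by auto
  have s: "?s u \<noteq> ?s w" using uw by simp
  note R2 = fill3_bigon[OF pts' _ uw s b nb F, unfolded E e, OF dg]
  show mem: "?E \<in> L" using R2 fill_empty(1) by blast
  show "p ?E w = - p ?E u" using R2 mem by blast
  show "p ?E v = p D v" if "v \<in> crossings D"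
  proof -
    have "v \<noteq> u" "v \<noteq> w" using that uw by blast+
    then show ?thesis using R2 mem that fill_empty(2)[OF that, of ?s] by auto
  qed
qed

section \<open>A strand across a bigon\<close>

text \<open>
  This is where the third Reidemeister move enters. Let the strands at \<open>x\<close> and \<open>z\<close> form a bigon with
  first crossing \<open>u\<close>, and pull the strand at \<open>t\<close> over or under both of them just before \<open>u\<close>: it forms
  a bigon with \<open>x\<close>, with crossings \<open>e\<close> and \<open>f\<close>, and then one with \<open>z\<close>, with crossings \<open>g\<close> and \<open>h\<close>.
  The crossings \<open>f\<close>, \<open>g\<close>, \<open>u\<close> are the vertices of a triangle. As \<open>f\<close> carries the negative of the
  value at \<open>e\<close>, the relation (P3+) becomes the equation below; each of its terms is computed after
  the removal of the two other bigons.
\<close>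

lemma third_strand:
  assumes pts: "{x, z, t} \<subseteq> points D" "distinct [x, z, t]"
    and names: "distinct [u, w, e, f, g, h]" "{u, w, e, f, g, h} \<inter> crossings D = {}"
  shows "p (R2_fill D True b u w x z) u
    = p (R2_fill D True (\<not> c) e f x t) e + p (R2_fill D False c g h t z) g"
proof -
  define s where "s v = (if v = u then b else if v = w then \<not> b else (v = f \<or> v = g) = c)" for v
  define E where "E X Z T = fill3 D x z t s X Z T" for X Z T
  let ?X = "[(e, \<not> c), (f, \<not> c), (u, b), (w, b)]"
  let ?Z = "[(h, \<not> c), (g, \<not> c), (u, \<not> b), (w, \<not> b)]"
  let ?T = "[(e, c), (f, c), (g, c), (h, c)]"
  let ?E0 = "E ?X ?Z ?T"
  let ?E1 = "E ?X [(u, \<not> b), (w, \<not> b)] [(e, c), (f, c)]"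
  let ?E2 = "E [(u, b), (w, b)] [(u, \<not> b), (w, \<not> b)] []"
  let ?E3 = "E [(e, \<not> c), (f, \<not> c)] [] [(e, c), (f, c)]"
  let ?E4 = "E [(e, \<not> c), (f, \<not> c)] [(h, \<not> c), (g, \<not> c)] ?T"
  let ?E5 = "E [] [(h, \<not> c), (g, \<not> c)] [(g, c), (h, c)]"
  have s: "s u = b" "s w = (\<not> b)" "s e = (\<not> c)" "s f = c" "s g = c" "s h = (\<not> c)"
    using names(1) by (auto simp: s_def)
  note bg = fill3_bigon[OF pts, where s = s, folded E_def]
  have nm: "u \<noteq> w" "u \<noteq> e" "u \<noteq> f" "u \<noteq> g" "u \<noteq> h" "w \<noteq> e" "w \<noteq> f" "w \<noteq> g" "w \<noteq> h"
    "e \<noteq> f" "e \<noteq> g" "e \<noteq> h" "f \<noteq> g" "f \<noteq> h" "g \<noteq> h"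
    "u \<notin> crossings D" "w \<notin> crossings D" "e \<notin> crossings D" "f \<notin> crossings D"
    "g \<notin> crossings D" "h \<notin> crossings D"
    using names by simp_all
  note simps = nm nm(1-15)[symmetric] s
  have E0: "diagram ?E0"
    unfolding E_def
  proof (rule diagram_fill3[OF diagram pts])
    show "distinct (?X @ ?Z @ ?T)" "fst ` set (?X @ ?Z @ ?T) \<inter> crossings D = {}"
      by (simp_all add: simps)
    show "(v, \<not> d) \<in> set (?X @ ?Z @ ?T)" if "(v, d) \<in> set (?X @ ?Z @ ?T)" for v d
      using that by (cases "d = c"; cases "d = b") auto
  qed
  \<comment> \<open>\<open>E0\<close> contains all three bigons. The bigon of \<open>x\<close> and \<open>z\<close> remains alone in \<open>E2\<close>, that of \<open>x\<close>
    and \<open>t\<close> in \<open>E3\<close> and that of \<open>t\<close> and \<open>z\<close> in \<open>E5\<close>.\<close>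
  have r1: "diagram ?E1 \<and> (?E1 \<in> L \<longleftrightarrow> ?E0 \<in> L) \<and> (?E0 \<in> L \<longrightarrow> p ?E0 h = - p ?E0 g \<and>
      (\<forall>v \<in> crossings D \<union> fst ` set (?X @ ?Z @ ?T) - {g, h}. p ?E0 v = p ?E1 v))"
    by (rule bg[OF E0, where b = c]) (simp_all add: simps)
  then have E1: "diagram ?E1" by blast
  have r2: "diagram ?E2 \<and> (?E2 \<in> L \<longleftrightarrow> ?E1 \<in> L) \<and> (?E1 \<in> L \<longrightarrow> p ?E1 f = - p ?E1 e \<and>
      (\<forall>v \<in> crossings D \<union> fst ` set (?X @ [(u, \<not> b), (w, \<not> b)] @ [(e, c), (f, c)]) - {e, f}.
        p ?E1 v = p ?E2 v))"
    by (rule bg[OF E1, where b = c]) (simp_all add: simps)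
  have r3: "diagram ?E3 \<and> (?E3 \<in> L \<longleftrightarrow> ?E1 \<in> L) \<and> (?E1 \<in> L \<longrightarrow> p ?E1 w = - p ?E1 u \<and>
      (\<forall>v \<in> crossings D \<union> fst ` set (?X @ [(u, \<not> b), (w, \<not> b)] @ [(e, c), (f, c)]) - {u, w}.
        p ?E1 v = p ?E3 v))"
    by (rule bg[OF E1, where b = b]) (simp_all add: simps)
  have r4: "diagram ?E4 \<and> (?E4 \<in> L \<longleftrightarrow> ?E0 \<in> L) \<and> (?E0 \<in> L \<longrightarrow> p ?E0 w = - p ?E0 u \<and>
      (\<forall>v \<in> crossings D \<union> fst ` set (?X @ ?Z @ ?T) - {u, w}. p ?E0 v = p ?E4 v))"
    by (rule bg[OF E0, where b = b]) (simp_all add: simps)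
  then have E4: "diagram ?E4" by blast
  have r5: "diagram ?E5 \<and> (?E5 \<in> L \<longleftrightarrow> ?E4 \<in> L) \<and> (?E4 \<in> L \<longrightarrow> p ?E4 f = - p ?E4 e \<and>
      (\<forall>v \<in> crossings D \<union> fst ` set ([(e, \<not> c), (f, \<not> c)] @ [(h, \<not> c), (g, \<not> c)] @ ?T) - {e, f}.
        p ?E4 v = p ?E5 v))"
    by (rule bg[OF E4, where b = c]) (simp_all add: simps)
  \<comment> \<open>The sign functions differ from \<open>s\<close> only away from the remaining crossings.\<close>
  have c2: "R2_fill D True b u w x z
      = fill3 D x z t (\<lambda>v. (v = u) = b) [(u, b), (w, b)] [(u, \<not> b), (w, \<not> b)] []"
    unfolding R2_fill_def by (rule arg_cong2[where f = "fill D"]) (use pts(2) in auto)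
  have c3: "R2_fill D True (\<not> c) e f x t
      = fill3 D x z t (\<lambda>v. (v = e) = (\<not> c)) [(e, \<not> c), (f, \<not> c)] [] [(e, c), (f, c)]"
    unfolding R2_fill_def by (rule arg_cong2[where f = "fill D"]) (use pts(2) in auto)
  have c5: "R2_fill D False c g h t z
      = fill3 D x z t (\<lambda>v. (v = g) = c) [] [(h, \<not> c), (g, \<not> c)] [(g, c), (h, c)]"
    unfolding R2_fill_def by (rule arg_cong2[where f = "fill D"]) (use pts(2) in auto)
  have "x \<in> points D" "z \<in> points D" "x \<noteq> z" using pts by simp_all
  then have L2: "R2_fill D True b u w x z \<in> L"
    by (rule R2_fill_facts) (simp_all add: simps)
  have p2: "?E2 \<in> L" "p ?E2 u = p (R2_fill D True b u w x z) u"
    using fill3_sign_cong[OF pts, where s = s and X = "[(u, b), (w, b)]" and Z = "[(u, \<not> b), (w, \<not> b)]" and T = "[]"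
        and s' = "\<lambda>v. (v = u) = b" and v = u] r2 L2
    unfolding c2 E_def by (simp_all add: simps)
  then have mem: "?E0 \<in> L" "?E1 \<in> L" "?E3 \<in> L" "?E4 \<in> L" "?E5 \<in> L"
    using r1 r2 r3 r4 r5 by blast+
  have p3: "p ?E3 e = p (R2_fill D True (\<not> c) e f x t) e"
    using fill3_sign_cong(2)[OF pts, where s = s and X = "[(e, \<not> c), (f, \<not> c)]" and Z = "[]" and T = "[(e, c), (f, c)]"
        and s' = "\<lambda>v. (v = e) = (\<not> c)" and v = e] r3 mem(3)
    unfolding c3 E_def by (simp add: simps)
  have p5: "p ?E5 g = p (R2_fill D False c g h t z) g"
    using fill3_sign_cong(2)[OF pts, where s = s and X = "[]" and Z = "[(h, \<not> c), (g, \<not> c)]" and T = "[(g, c), (h, c)]"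
        and s' = "\<lambda>v. (v = g) = c" and v = g] r5 mem(5)
    unfolding c5 E_def by (simp add: simps)
  have "p ?E0 u = p ?E0 g - p ?E0 f"
  proof (rule oriented_parity_triangle[OF oriented_parity mem(1) E0, of f g u c b])
    show "follows ?E0 (f, c) (g, c)"
      unfolding E_def by (rule fill_follows_point[of t]) (use pts in simp_all)
    show "follows ?E0 (g, \<not> c) (u, \<not> b)"
      unfolding E_def by (rule fill_follows_point[of z]) (use pts in simp_all)
    show "follows ?E0 (f, \<not> c) (u, b)"
      unfolding E_def by (rule fill_follows_point[of x]) (use pts in simp_all)
  qed (simp_all add: simps E_def positive_fill)
  moreover have "p ?E0 f = - p ?E0 e"
    by (rule bg[OF E0, where b = c, THEN conjunct2, THEN conjunct2, THEN mp, THEN conjunct1])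
      (simp_all add: simps mem(1))
  moreover have "p ?E0 u = p ?E2 u" "p ?E0 e = p ?E3 e" "p ?E0 g = p ?E5 g"
    using r1 r2 r3 r4 r5 mem by (simp_all add: simps)
  ultimately show ?thesis
    using p2 p3 p5 by simp
qed

end

section \<open>The linking values of arcs\<close>

lemma fill_cong:
  assumes "\<And>a. arc_word \<tau> a = arc_word \<tau>' a" shows "fill D \<tau> s = fill D \<tau>' s"
proof -
  have "fill_word D \<tau> = fill_word D \<tau>'"
    using assms by (simp add: fill_word_def fun_eq_iff)
  then show ?thesis by (simp add: fill_def)
qed

lemma comps_fill_single:
  assumes a: "a \<in> arcs D" "a = (i, k)" and \<tau>: "\<And>a'. a' \<noteq> a \<Longrightarrow> arc_word \<tau> a' = []"
  shows "comps (fill D \<tau> s)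
    = (comps D)[i := take (Suc k) (comps D ! i) @ arc_word \<tau> a @ drop (Suc k) (comps D ! i)]"
proof (rule nth_equalityI)
  fix j assume "j < length (comps (fill D \<tau> s))"
  then have j: "j < length (comps D)" by (simp add: fill_def)
  let ?W = "comps D ! j"
  have word: "concat (map (\<lambda>m. ?W ! m # arc_word \<tau> (j, m)) [l..<r]) = take (r - l) (drop l ?W)"
    if "\<And>m. l \<le> m \<Longrightarrow> m < r \<Longrightarrow> (j, m) \<noteq> a" "r \<le> length ?W" for l r
  proof -
    have "map (\<lambda>m. ?W ! m # arc_word \<tau> (j, m)) [l..<r] = map (\<lambda>m. [?W ! m]) [l..<r]"
      using that(1) \<tau> by auto
    then have "concat (map (\<lambda>m. ?W ! m # arc_word \<tau> (j, m)) [l..<r]) = map ((!) ?W) [l..<r]"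
      by (simp only: concat_map_singleton)
    also have "\<dots> = take (r - l) (drop l ?W)"
      using that(2) by (auto intro: nth_equalityI)
    finally show ?thesis .
  qed
  show "comps (fill D \<tau> s) ! j
    = (comps D)[i := take (Suc k) (comps D ! i) @ arc_word \<tau> a @ drop (Suc k) (comps D ! i)] ! j"
  proof (cases "j = i")
    case False
    then show ?thesis
      using j a(2) word[of 0 "length ?W"] \<tau> by (simp add: fill_def fill_word_def)
  next
    case True
    show ?thesis
    proof (cases "?W = []")
      case True
      then have "k = 0" using a \<open>j = i\<close> by (simp add: arcs_def)
      then show ?thesis using j a(2) True \<open>j = i\<close> by (simp add: fill_def fill_word_def)
    next
      case False
      then have k: "k < length ?W" using a \<open>j = i\<close> by (cases ?W) (simp_all add: arcs_def)
      then have "[0..<length ?W] = [0..<k] @ k # [Suc k..<length ?W]"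
        using upt_add_eq_append[of 0 k "length ?W - k"] by (simp add: upt_conv_Cons)
      then have "fill_word D \<tau> j = take k ?W @ (?W ! k # arc_word \<tau> a) @ drop (Suc k) ?W"
        using word[of 0 k] word[of "Suc k" "length ?W"] k False a(2) \<open>j = i\<close>
        by (simp add: fill_word_def)
      then show ?thesis
        using j k \<open>j = i\<close> by (simp add: fill_def take_Suc_conv_app_nth)
    qed
  qed
qed (simp add: fill_def)

definition fresh_name :: "vdiagram \<Rightarrow> nat" where
  "fresh_name D = Suc (Max (insert 0 (crossings D)))"

lemma fresh_name: "n \<ge> fresh_name D \<Longrightarrow> n \<notin> crossings D"
proof
  assume "n \<ge> fresh_name D" "n \<in> crossings D"
  moreover have "finite (insert 0 (crossings D))" by (simp add: crossings_def)
  ultimately show False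
    unfolding fresh_name_def by (meson Max_ge insertI2 not_less_eq_eq)
qed

lemma arc_word_two_points:
  "a \<noteq> b \<Longrightarrow> arc_word ((\<lambda>_. [])((a, i) := X, (b, j) := Z)) c
    = (if c = a then X else if c = b then Z else [])"
  by (cases i; cases j; simp add: arc_word_def)

lemma R2_fill_slots:
  "a \<noteq> b \<Longrightarrow> R2_fill D par \<beta> u w (a, i) (b, j) = R2_fill D par \<beta> u w (a, i') (b, j')"
  "R2_fill D par \<beta> u w (a, Front) (a, Middle) = R2_fill D par \<beta> u w (a, Front) (a, Back)"
  "R2_fill D par \<beta> u w (a, Middle) (a, Back) = R2_fill D par \<beta> u w (a, Front) (a, Back)"
  "R2_fill D par \<beta> u w (a, Middle) (a, Front) = R2_fill D par \<beta> u w (a, Back) (a, Front)"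
  "R2_fill D par \<beta> u w (a, Back) (a, Middle) = R2_fill D par \<beta> u w (a, Back) (a, Front)"
  unfolding R2_fill_def
  by (rule fill_cong, simp add: arc_word_two_points)
    (rule fill_cong, simp add: arc_word_def)+

lemma crossings_R2_fill:
  assumes "x \<in> points D" "z \<in> points D" "x \<noteq> z"
  shows "crossings (R2_fill D par b u w x z) = crossings D \<union> {u, w}"
proof -
  let ?\<tau> = "(\<lambda>_. [])(x := [(u, b), (w, b)],
         z := if par then [(u, \<not> b), (w, \<not> b)] else [(w, \<not> b), (u, \<not> b)])"
  have "(\<Union>q\<in>points D. fst ` set (?\<tau> q)) = (\<Union>q\<in>{x, z}. fst ` set (?\<tau> q))"
    using assms by (intro equalityI UN_mono UN_least) (auto split: if_splits)
  also have "\<dots> = {u, w}" using assms(3) by auto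
  finally show ?thesis by (simp only: R2_fill_def crossings_fill)
qed

context parity_on_diagram
begin

text \<open>
  The value at the first crossing of a bigon between parallel strands, the strand at \<open>x\<close> coming from
  SW there. The chosen names and the upper strand stand for any others.
\<close>

definition parallel_value :: "point \<Rightarrow> point \<Rightarrow> 'a" where
  "parallel_value x z = (let u = fresh_name D in p (R2_fill D True True u (Suc u) x z) u)"

text \<open>
  On the right of the equation in \<open>third_strand\<close> neither the names of the two crossings nor the
  choice of the upper strand between \<open>x\<close> and \<open>z\<close> occur, hence the left side does not depend on them.
\<close>

lemma parallel_value:
  assumes pts: "x \<in> points D" "z \<in> points D" "x \<noteq> z"
    and uw: "u \<noteq> w" "u \<notin> crossings D" "w \<notin> crossings D"
  shows "p (R2_fill D True b u w x z) u = parallel_value x z"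
proof -
  obtain t where t: "t \<in> points D" "t \<noteq> x" "t \<noteq> z" using third_point[OF pts(1)] .
  define u0 where "u0 = fresh_name D"
  have u0: "u0 \<notin> crossings D" "Suc u0 \<notin> crossings D"
    unfolding u0_def by (rule fresh_name, simp)+
  obtain ns where ns: "length ns = 4" "distinct ns"
      "set ns \<inter> (crossings D \<union> set [u, w, u0, Suc u0]) = {}"
    using fresh_crossings by blast
  then obtain e f g h where efgh: "ns = [e, f, g, h]"
    by (auto simp: numeral_eq_Suc length_Suc_conv)
  have names: "p (R2_fill D True b' u' w' x z) u'
      = p (R2_fill D True False e f x t) e + p (R2_fill D False True g h t z) g"
    if "u' \<noteq> w'" "{u', w'} \<inter> crossings D = {}" "{u', w'} \<subseteq> {u, w, u0, Suc u0}" for b' u' w'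
    using third_strand[of x z t u' w' e f g h b' True] pts t that ns(2,3) unfolding efgh
    by auto
  show ?thesis
    using names[of u w b] names[of u0 "Suc u0" True] uw u0
    by (simp add: parallel_value_def u0_def[symmetric] Let_def)
qed

lemma antiparallel_value:
  assumes pts: "{x, t, z} \<subseteq> points D" "distinct [x, t, z]"
    and gh: "g \<noteq> h" "g \<notin> crossings D" "h \<notin> crossings D"
  shows "p (R2_fill D False c g h t z) g = parallel_value x z - parallel_value x t"
proof -
  obtain ns where ns: "length ns = 4" "distinct ns" "set ns \<inter> (crossings D \<union> set [g, h]) = {}"
    using fresh_crossings by blast
  then obtain u w e f where uwef: "ns = [u, w, e, f]"
    by (auto simp: numeral_eq_Suc length_Suc_conv)
  have "p (R2_fill D True True u w x z) u
      = p (R2_fill D True (\<not> c) e f x t) e + p (R2_fill D False c g h t z) g"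
    using third_strand[of x z t u w e f g h True c] pts ns(2,3) gh unfolding uwef by auto
  moreover have "p (R2_fill D True True u w x z) u = parallel_value x z"
    "p (R2_fill D True (\<not> c) e f x t) e = parallel_value x t"
    using pts ns(2,3) unfolding uwef by (auto intro!: parallel_value)
  ultimately show ?thesis by simp
qed

text \<open>
  The slots make the two points distinct also for \<open>a = b\<close>.
\<close>

definition linking :: "arc \<Rightarrow> arc \<Rightarrow> 'a" where
  "linking a b = parallel_value (a, Front) (b, Back)"

text \<open>
  A slot can be exchanged for another one on the same arc without changing the diagram, as long as
  the strand does not pass the other point. If both points are on one arc, their order has to be
  reversed. The antiparallel diagrams with the points \<open>(Middle, Front)\<close> and \<open>(Back, Front)\<close> are
  equal; expressed by parallel values seen from \<open>Back\<close> and from \<open>Middle\<close>, respectively, their common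
  value is a difference of two equal terms in the first case and the difference of the values for
  the two orders in the second case.
\<close>

lemma parallel_value_linking:
  assumes ab: "a \<in> arcs D" "b \<in> arcs D" and ne: "(a, i) \<noteq> (b, j)"
  shows "parallel_value (a, i) (b, j) = linking a b"
proof (cases "a = b")
  case False
  then show ?thesis
    unfolding linking_def parallel_value_def using R2_fill_slots(1)[of a b] by metis
next
  case True
  note [simp] = \<open>a = b\<close>
  have pts: "(b, i) \<in> points D" for i using ab by (simp add: points_def)
  have slots: "parallel_value (b, Front) (b, Middle) = linking b b"
    "parallel_value (b, Middle) (b, Back) = linking b b"
    "parallel_value (b, Middle) (b, Front) = parallel_value (b, Back) (b, Front)"
    "parallel_value (b, Back) (b, Middle) = parallel_value (b, Back) (b, Front)"
    by (simp_all add: parallel_value_def linking_def R2_fill_slots(2-5))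
  define u where "u = fresh_name D"
  have u: "u \<notin> crossings D" "Suc u \<notin> crossings D"
    unfolding u_def by (rule fresh_name, simp)+
  have "parallel_value (b, Back) (b, Front) - parallel_value (b, Back) (b, Middle)
      = parallel_value (b, Middle) (b, Front) - parallel_value (b, Middle) (b, Back)"
    using antiparallel_value[of "(b, Back)" "(b, Middle)" "(b, Front)" u "Suc u" True]
      antiparallel_value[of "(b, Middle)" "(b, Back)" "(b, Front)" u "Suc u" True]
      pts u by (simp add: R2_fill_slots(4))
  then have "parallel_value (b, Back) (b, Front) = linking b b"
    by (simp add: slots)
  then show ?thesis
    using ne slots by (cases i; cases j) (auto simp: linking_def)
qed

text \<open>
  The left side does not mention \<open>x\<close>. So the functions \<open>linking x\<close> for different \<open>x\<close> differ by
  constants, and every crossing between antiparallel strands measures an increment of them.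
\<close>

lemma antiparallel_value_linking:
  assumes "x \<in> arcs D" "a \<in> arcs D" "b \<in> arcs D" "(a, i) \<noteq> (b, j)"
    and "g \<noteq> h" "g \<notin> crossings D" "h \<notin> crossings D"
  shows "p (R2_fill D False c g h (a, i) (b, j)) g = linking x b - linking x a"
proof -
  obtain m where m: "m \<noteq> i" "m \<noteq> j"
    by (metis slot.distinct)
  have "p (R2_fill D False c g h (a, i) (b, j)) g
      = parallel_value (x, m) (b, j) - parallel_value (x, m) (a, i)"
    using assms m by (intro antiparallel_value) (auto simp: points_def)
  then show ?thesis
    using assms m parallel_value_linking[of x b m j] parallel_value_linking[of x a m i] by simp
qed

lemma linking_difference:
  assumes "x \<in> arcs D" "y \<in> arcs D" "a \<in> arcs D" "b \<in> arcs D"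
  shows "linking x b - linking x a = linking y b - linking y a"
proof -
  have "fresh_name D \<notin> crossings D" "Suc (fresh_name D) \<notin> crossings D"
    by (rule fresh_name, simp)+
  then show ?thesis
    using assms antiparallel_value_linking[of _ a b Front Back "fresh_name D" "Suc (fresh_name D)"]
    by (metis n_not_Suc_n prod.inject slot.distinct(3))
qed

text \<open>
  If the first of the two subsegments comes from SW at \<open>u\<close>, the diagram is a bigon between the points
  \<open>Front\<close> and \<open>Back\<close>, otherwise between \<open>Back\<close> and \<open>Front\<close>. As the value is the same for both
  orders, the diagonal of \<open>linking\<close> is the parity cycle.
\<close>

lemma double_arc_value:
  assumes a: "a \<in> arcs D" and uw: "u \<noteq> w" "u \<notin> crossings D" "w \<notin> crossings D"
  shows "p (double_arc D a u w b s) u = linking a a"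
proof -
  define E where "E = (if s = b then R2_fill D True b u w (a, Front) (a, Back)
    else R2_fill D True (\<not> b) u w (a, Back) (a, Front))"
  obtain i k where ik: "a = (i, k)" by (cases a)
  have pts: "(a, c) \<in> points D" for c using a by (simp add: points_def)
  have E: "diagram E" "E \<in> L" "p E u = linking a a"
    unfolding E_def using R2_fill_facts(1,2)[OF pts pts] parallel_value[OF pts pts] uw
      parallel_value_linking[OF a a] by auto
  have "comps E = (comps D)[i := take (Suc k) (comps D ! i) @ [(u, b), (w, b), (u, \<not> b), (w, \<not> b)]
      @ drop (Suc k) (comps D ! i)]"
    unfolding E_def R2_fill_def
    using comps_fill_single[OF a ik] by (auto simp: arc_word_def)
  then have c: "comps (double_arc D a u w b s) = comps E"
    by (simp add: double_arc_def ik)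
  have cr: "crossings E = crossings D \<union> {u, w}"
    unfolding E_def using crossings_R2_fill[OF pts pts] by simp
  have "positive (double_arc D a u w b s) v = positive E v" if "v \<in> crossings E" for v
    using that cr uw by (auto simp: E_def R2_fill_def double_arc_def ik positive_fill)
  then have "p (double_arc D a u w b s) u = p E u"
    using sign_irrelevant(2)[OF E(1) c _ E(2), of u] cr by blast
  then show ?thesis using E(3) by simp
qed

lemma parity_cycle_eq_linking:
  assumes "a \<in> arcs D" shows "parity_cycle p D a = linking a a"
proof -
  have "fresh_name D \<notin> crossings D" "Suc (fresh_name D) \<notin> crossings D"
    by (rule fresh_name, simp)+
  then have "arc_value p D a = linking a a"
    unfolding arc_value_def using double_arc_value[OF assms]
    by (intro the_equality) (metis n_not_Suc_n, blast)
  then show ?thesis using assms by (simp add: parity_cycle_def)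
qed

section \<open>A potential for the parity\<close>

lemma corner_arcs:
  assumes v: "v \<in> crossings D"
  shows "sw D v \<in> open_arcs D" "se D v \<in> open_arcs D" "ne D v \<in> open_arcs D" "nw D v \<in> open_arcs D"
    and "head D (sw D v) = (v, positive D v)" "head D (se D v) = (v, \<not> positive D v)"
    and "tail D (ne D v) = (v, positive D v)" "tail D (nw D v) = (v, \<not> positive D v)"
  unfolding sw_def se_def ne_def nw_def
  using arc_from[OF diagram v] arc_to[OF diagram v] by simp_all

lemma open_arcs_subset: "open_arcs D \<subseteq> arcs D"
  by (auto simp: open_arcs_def arcs_def)

text \<open>
  Next to a crossing \<open>v\<close> one can make a bigon of two of the four adjacent arcs such that one of its
  crossings bounds a second bigon with \<open>v\<close>. Two crossings of a common bigon have opposite values, so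
  the value at \<open>v\<close> is up to sign that at \<open>u\<close>. The strands are parallel for the two arcs that enter
  \<open>v\<close> and for the two that leave it, and antiparallel on the west side.
\<close>

lemma parity_linking:
  assumes v: "v \<in> crossings D"
  shows "linking (sw D v) (se D v) = p D v"
    and "linking (nw D v) (ne D v) = - p D v"
    and "x \<in> arcs D \<Longrightarrow> linking x (nw D v) - linking x (sw D v) = p D v"
proof -
  define \<beta> where "\<beta> = positive D v"
  define u w where "u = fresh_name D" and "w = Suc u"
  have uw: "u \<noteq> w" "u \<notin> crossings D" "w \<notin> crossings D" "u \<noteq> v" "w \<noteq> v"
    using fresh_name[of D u] fresh_name[of D w] v by (auto simp: u_def w_def)
  note arcs = corner_arcs[OF v, folded \<beta>_def]
  have in_arcs: "sw D v \<in> arcs D" "se D v \<in> arcs D" "ne D v \<in> arcs D" "nw D v \<in> arcs D"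
    using arcs(1-4) open_arcs_subset by auto
  have ne: "sw D v \<noteq> se D v" "nw D v \<noteq> ne D v"
    using arcs(5-8) by auto
  have pts: "(sw D v, c) \<in> points D" "(se D v, c) \<in> points D" "(ne D v, c) \<in> points D"
    "(nw D v, c) \<in> points D" for c
    using in_arcs by (simp_all add: points_def)
  have sign: "positive (R2_fill D par b u w x z) v = \<beta>"
    "positive (R2_fill D par b u w x z) u = b" "positive (R2_fill D par b u w x z) w = (\<not> b)"
    for par b x z
    using v uw by (simp_all add: R2_fill_def positive_fill \<beta>_def)
  show "linking (sw D v) (se D v) = p D v"
  proof -
    let ?x = "(sw D v, Back)" and ?z = "(se D v, Back)"
    let ?E = "R2_fill D True \<beta> u w ?x ?z"
    have xz: "?x \<noteq> ?z" using ne by simp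
    note E = R2_fill_facts[OF pts(1,2) xz uw(1-3), where par = True and b = \<beta>]
    have "follows ?E (w, \<beta>) (v, \<beta>)" unfolding R2_fill_def
      by (rule fill_follows[OF arcs(1)]) (simp add: arcs ne arc_word_def)
    moreover have "follows ?E (w, \<not> \<beta>) (v, \<not> \<beta>)" unfolding R2_fill_def
      by (rule fill_follows[OF arcs(2)]) (simp add: arcs ne[symmetric] arc_word_def)
    ultimately have "bigon ?E w v"
      using uw sign[of True \<beta>] unfolding bigon_def by auto
    then have "p ?E w + p ?E v = 0" using bigon_in_link(2) E(1,2) by blast
    then have "p ?E u = p D v" using E(3) E(4)[OF v] by (simp add: add_eq_0_iff)
    then show ?thesis
      using parallel_value[OF pts(1,2) xz uw(1-3)] parallel_value_linking[OF in_arcs(1,2) xz] by simp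
  qed
  show "linking (nw D v) (ne D v) = - p D v"
  proof -
    let ?x = "(nw D v, Front)" and ?z = "(ne D v, Front)"
    let ?E = "R2_fill D True (\<not> \<beta>) u w ?x ?z"
    have xz: "?x \<noteq> ?z" using ne by simp
    note E = R2_fill_facts[OF pts(4,3) xz uw(1-3), where par = True and b = "\<not> \<beta>"]
    have "follows ?E (v, \<not> \<beta>) (u, \<not> \<beta>)" unfolding R2_fill_def
      by (rule fill_follows[OF arcs(4)]) (simp add: arcs ne arc_word_def)
    moreover have "follows ?E (v, \<beta>) (u, \<beta>)" unfolding R2_fill_def
      by (rule fill_follows[OF arcs(3)]) (simp add: arcs ne[symmetric] arc_word_def)
    ultimately have "bigon ?E v u"
      using uw sign[of True "\<not> \<beta>"] unfolding bigon_def by auto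
    then have "p ?E v + p ?E u = 0" using bigon_in_link(2) E(1,2) by blast
    then have "p ?E u = - p D v" using E(4)[OF v] by (simp add: add_eq_0_iff)
    then show ?thesis
      using parallel_value[OF pts(4,3) xz uw(1-3)] parallel_value_linking[OF in_arcs(4,3) xz] by simp
  qed
  show "linking x (nw D v) - linking x (sw D v) = p D v" if x: "x \<in> arcs D"
  proof -
    \<comment> \<open>The arcs NW and SW may coincide; with these slots the two words are still next to \<open>v\<close>.\<close>
    let ?x = "(sw D v, Back)" and ?z = "(nw D v, Front)"
    let ?E = "R2_fill D False \<beta> u w ?x ?z"
    have xz: "?x \<noteq> ?z" by simp
    note E = R2_fill_facts[OF pts(1,4) xz uw(1-3), where par = False and b = \<beta>]
    have "follows ?E (w, \<beta>) (v, \<beta>)" unfolding R2_fill_def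
      by (rule fill_follows[OF arcs(1)]) (auto simp add: arcs arc_word_def)
    moreover have "follows ?E (v, \<not> \<beta>) (w, \<not> \<beta>)" unfolding R2_fill_def
      by (rule fill_follows[OF arcs(4)]) (auto simp add: arcs arc_word_def)
    ultimately have "bigon ?E w v"
      using uw sign[of False \<beta>] unfolding bigon_def by auto
    then have "p ?E w + p ?E v = 0" using bigon_in_link(2) E(1,2) by blast
    then have "p ?E u = p D v" using E(3) E(4)[OF v] by (simp add: add_eq_0_iff)
    then show ?thesis
      using antiparallel_value_linking[OF x in_arcs(1,4) xz uw(1-3)] by simp
  qed
qed

text \<open>
  The function \<open>linking x\<close> jumps at crossings. Its value at a passage is read off before the crossing
  on the strand from SW to NE, and after it on the strand from SE to NW: then both values belong to
  arcs on the west side of the crossing, and their difference is the parity.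
\<close>

definition potential :: "passage \<Rightarrow> 'a" where
  "potential x = linking (SOME a. a \<in> arcs D)
     (if snd x = positive D (fst x) then sw D (fst x) else nw D (fst x))"

lemma parity_eq_potential_difference:
  assumes v: "v \<in> crossings D"
  shows "p D v = potential (v, \<not> positive D v) - potential (v, positive D v)"
proof -
  have "(SOME a. a \<in> arcs D) \<in> arcs D"
    using corner_arcs(1)[OF v] open_arcs_subset by (metis someI subsetD)
  then show ?thesis using parity_linking(3)[OF v] by (simp add: potential_def)
qed

text \<open>
  Across a crossing the function \<open>linking x\<close> decreases by \<open>\<delta>\<close> of the arc NW on the strand from SW to
  NE, and increases by \<open>\<delta>\<close> of the arc SW on the other strand. At exactly these places, and with the
  opposite coefficients, the copy of the graph pushed to the left meets the cycle \<open>\<delta>\<close>. As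
  \<open>linking x\<close> is constant on \<open>a\<close>, the intersection number of \<open>a\<close> consists of the jumps by which
  the potential at the two ends of \<open>a\<close> may differ from this constant.
\<close>

lemma intersection_single_arc:
  assumes a: "a \<in> open_arcs D"
  shows "intersection D (chain [a]) (parity_cycle p D)
    = potential (tail D a) - potential (head D a)"
proof -
  let ?\<delta> = "parity_cycle p D"
  define a0 where "a0 = (SOME a. a \<in> arcs D)"
  have a0: "a0 \<in> arcs D"
    unfolding a0_def using a open_arcs_subset by (metis someI subsetD)
  define out where "out x = (if snd x = positive D (fst x) then ?\<delta> (nw D (fst x)) else 0)" for x
  define inc where "inc x = (if snd x = positive D (fst x) then 0 else ?\<delta> (sw D (fst x)))" for x
  have arc: "b \<in> arcs D" if "b \<in> open_arcs D" for b using that open_arcs_subset by blast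
  have step: "linking a0 (ne D v) = linking a0 (sw D v) - ?\<delta> (nw D v)"
    "linking a0 (nw D v) = linking a0 (se D v) + ?\<delta> (sw D v)" if v: "v \<in> crossings D" for v
  proof -
    note arcs = corner_arcs(1-4)[OF v, THEN arc]
    have "?\<delta> (sw D v) = linking (sw D v) (sw D v)" "?\<delta> (nw D v) = linking (nw D v) (nw D v)"
      using arcs by (simp_all add: parity_cycle_eq_linking)
    then show "linking a0 (ne D v) = linking a0 (sw D v) - ?\<delta> (nw D v)"
      "linking a0 (nw D v) = linking a0 (se D v) + ?\<delta> (sw D v)"
      using parity_linking(1,2)[OF v] parity_linking(3)[OF v arcs(4)] parity_linking(3)[OF v arcs(1)]
        linking_difference[OF a0 arcs(4) arcs(1) arcs(3)]
        linking_difference[OF a0 arcs(1) arcs(2) arcs(4)]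
      by (simp_all add: algebra_simps)
  qed
  have tail: "fst (tail D a) \<in> crossings D" and head: "fst (head D a) \<in> crossings D"
    using bij_betwE[OF bij_betw_tail[OF diagram]] bij_betwE[OF bij_betw_head[OF diagram]] a
      passages_crossings[OF diagram] by (auto simp: mem_Times_iff simp del: set_concat)
  have at_tail: "potential (tail D a) = linking a0 a + out (tail D a)"
  proof (cases "snd (tail D a) = positive D (fst (tail D a))")
    case True
    then have "(fst (tail D a), positive D (fst (tail D a))) = tail D a" by (simp add: prod_eq_iff)
    then have "ne D (fst (tail D a)) = a"
      by (simp only: ne_def arc_from_eqI[OF diagram a])
    then show ?thesis
      using step(1)[OF tail] True by (simp add: potential_def a0_def[symmetric] out_def)
  next
    case False
    then have "(fst (tail D a), \<not> positive D (fst (tail D a))) = tail D a" by (simp add: prod_eq_iff)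
    then have "nw D (fst (tail D a)) = a"
      by (simp only: nw_def arc_from_eqI[OF diagram a])
    then show ?thesis using False by (simp add: potential_def a0_def[symmetric] out_def)
  qed
  have at_head: "potential (head D a) = linking a0 a + inc (head D a)"
  proof (cases "snd (head D a) = positive D (fst (head D a))")
    case True
    then have "(fst (head D a), positive D (fst (head D a))) = head D a" by (simp add: prod_eq_iff)
    then have "sw D (fst (head D a)) = a"
      by (simp only: sw_def arc_to_eqI[OF diagram a])
    then show ?thesis using True by (simp add: potential_def a0_def[symmetric] inc_def)
  next
    case False
    then have "(fst (head D a), \<not> positive D (fst (head D a))) = head D a" by (simp add: prod_eq_iff)
    then have "se D (fst (head D a)) = a"
      by (simp only: se_def arc_to_eqI[OF diagram a])
    then show ?thesis
      using step(2)[OF head] False by (simp add: potential_def a0_def[symmetric] inc_def)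
  qed
  have "int_scale (chain [a] (ne D v)) (?\<delta> (nw D v)) - int_scale (chain [a] (se D v)) (?\<delta> (sw D v))
      = (if v = fst (tail D a) then out (tail D a) else 0)
        - (if v = fst (head D a) then inc (head D a) else 0)"
    if v: "v \<in> crossings D" for v
  proof -
    have single: "int_scale (chain [a] b) y = (if b = a then y else 0)" for b and y :: 'a
      by (simp add: chain_def int_scale_def)
    have "ne D v = a \<longleftrightarrow> v = fst (tail D a) \<and> snd (tail D a) = positive D v"
    proof
      assume "ne D v = a"
      then have "tail D a = (v, positive D v)" using corner_arcs(7)[OF v] by simp
      then show "v = fst (tail D a) \<and> snd (tail D a) = positive D v" by simp
    next
      assume "v = fst (tail D a) \<and> snd (tail D a) = positive D v"
      then have "(v, positive D v) = tail D a" by (simp add: prod_eq_iff)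
      then show "ne D v = a" by (simp only: ne_def arc_from_eqI[OF diagram a])
    qed
    moreover have "se D v = a \<longleftrightarrow> v = fst (head D a) \<and> snd (head D a) = (\<not> positive D v)"
    proof
      assume "se D v = a"
      then have "head D a = (v, \<not> positive D v)" using corner_arcs(6)[OF v] by simp
      then show "v = fst (head D a) \<and> snd (head D a) = (\<not> positive D v)" by simp
    next
      assume "v = fst (head D a) \<and> snd (head D a) = (\<not> positive D v)"
      then have "(v, \<not> positive D v) = head D a" by (simp add: prod_eq_iff)
      then show "se D v = a" by (simp only: se_def arc_to_eqI[OF diagram a])
    qed
    ultimately show ?thesis
      unfolding single out_def inc_def by (intro arg_cong2[where f = minus]) simp_all
  qed
  then have "intersection D (chain [a]) ?\<delta>
      = (\<Sum>v\<in>crossings D. (if v = fst (tail D a) then out (tail D a) else 0)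
        - (if v = fst (head D a) then inc (head D a) else 0))"
    unfolding intersection_def by (rule sum.cong[OF refl])
  also have "\<dots> = out (tail D a) - inc (head D a)"
  proof -
    have "finite (crossings D)" by (simp add: crossings_def)
    then show ?thesis using tail head by (simp add: sum_subtractf)
  qed
  finally show ?thesis by (simp add: at_tail at_head)
qed

end

section \<open>Telescoping along paths\<close>

lemma int_scale_add_nat:
  fixes x :: "'a::ab_group_add"
  shows "int_scale (int m + int n) x = int_scale (int m) x + int_scale (int n) x"
proof -
  have "nat (int m + int n) = m + n" by simp
  moreover have "(\<Sum>k<m + n. x) = (\<Sum>k<m. x) + (\<Sum>k<n. x)"
    by (induction n) (simp_all add: add.assoc)
  ultimately show ?thesis by (simp add: int_scale_def)
qed

lemma intersection_append:
  fixes y :: "arc \<Rightarrow> 'a::ab_group_add"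
  shows "intersection D (chain (us @ vs)) y = intersection D (chain us) y + intersection D (chain vs) y"
  unfolding intersection_def sum.distrib[symmetric]
  by (rule sum.cong) (simp_all add: chain_def int_scale_add_nat)

lemma intersection_Nil: "intersection D (chain []) y = 0"
  by (simp add: intersection_def chain_def int_scale_def)

lemma intersection_sum_list:
  fixes y :: "arc \<Rightarrow> 'a::ab_group_add"
  shows "intersection D (chain w) y = (\<Sum>a\<leftarrow>w. intersection D (chain [a]) y)"
proof (induction w)
  case (Cons a w)
  then show ?case using intersection_append[of D "[a]" w y] by simp
qed (simp add: intersection_Nil)

lemma component_passage:
  assumes D: "diagram D" and x: "i < length (comps D)" "x \<in> set (comps D ! i)"
  obtains k where "k < length (comps D ! i)" "arc_from D x = (i, k)" "comps D ! i ! k = x"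
proof -
  obtain k where k: "k < length (comps D ! i)" "comps D ! i ! k = x"
    using x(2) by (auto simp: in_set_conv_nth)
  then have "(i, k) \<in> open_arcs D" "tail D (i, k) = x" using x(1) by (auto simp: open_arcs_def tail_def)
  then have "arc_from D x = (i, k)" using arc_from_eqI[OF D] by metis
  then show ?thesis using that k by blast
qed

text \<open>
  The last property is the telescoping sum: along a path the head of an arc is the tail of
  the next one. The fourth one holds because the path stops before it has gone once around the
  component.
\<close>

lemma path_properties:
  assumes D: "diagram D" and i: "i < length (comps D)"
    and x: "x \<in> set (comps D ! i)" and y: "y \<in> set (comps D ! i)" and ne: "x \<noteq> y"
  shows "path D x y \<noteq> []" and "hd (path D x y) = arc_from D x" and "last (path D x y) = arc_to D y"
    and "arc_to D x \<notin> set (path D x y)" and "set (path D x y) \<subseteq> open_arcs D \<inter> {i} \<times> UNIV"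
    and "\<And>M :: passage \<Rightarrow> 'a::ab_group_add.
      (\<Sum>a\<leftarrow>path D x y. M (tail D a) - M (head D a)) = M x - M y"
proof -
  obtain k where k: "k < length (comps D ! i)" "arc_from D x = (i, k)" "comps D ! i ! k = x"
    using component_passage[OF D i x] .
  obtain l where l: "l < length (comps D ! i)" "arc_from D y = (i, l)" "comps D ! i ! l = y"
    using component_passage[OF D i y] .
  define n where "n = length (comps D ! i)"
  define m where "m = (l + n - k) mod n"
  define a where "a t = (i, (k + t) mod n)" for t
  have kl: "k \<noteq> l" "k < n" "l < n" using ne k l by (auto simp: n_def)
  have m: "0 < m" "m < n" "(k + m) mod n = l"
  proof -
    have "m = (if k \<le> l then l - k else l + n - k)"
      using kl unfolding m_def by (auto simp: mod_if)
    then show "0 < m" "m < n" "(k + m) mod n = l" using kl by (auto split: if_splits)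
  qed
  have path: "path D x y = map a [0..<m]"
    by (simp add: path_def k(2) l(2) n_def[symmetric] m_def a_def)
  have tail_a: "tail D (a t) = comps D ! i ! ((k + t) mod n)" for t
    by (simp add: tail_def a_def)
  have head_a: "head D (a t) = tail D (a (Suc t))" for t
    by (simp add: head_def tail_def a_def n_def[symmetric] mod_Suc_eq)
  have a_open: "a t \<in> open_arcs D" for t
    using i kl by (simp add: open_arcs_def a_def n_def[symmetric])
  have tail_0: "tail D (a 0) = x" and tail_m: "tail D (a m) = y"
    using k l m kl by (simp_all add: tail_a)
  show "path D x y \<noteq> []" using m by (simp add: path)
  show "hd (path D x y) = arc_from D x"
    using m kl by (simp add: path k(2) hd_map a_def)
  show "last (path D x y) = arc_to D y"
  proof -
    have "head D (a (m - 1)) = y" using head_a[of "m - 1"] m tail_m by simp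
    then have "arc_to D y = a (m - 1)" using arc_to_eqI[OF D a_open] by metis
    then show ?thesis using m by (simp add: path last_map)
  qed
  show "arc_to D x \<notin> set (path D x y)"
  proof
    assume "arc_to D x \<in> set (path D x y)"
    then obtain t where t: "t < m" "arc_to D x = a t" by (auto simp: path)
    have "head D (a (n - 1)) = x" using head_a[of "n - 1"] kl k by (simp add: tail_a)
    then have "a t = a (n - 1)" using arc_to_eqI[OF D a_open] t(2) by metis
    then have "(k + t) mod n = (k + (n - 1)) mod n" by (simp add: a_def)
    then show False using t(1) m kl by (auto simp: mod_if split: if_splits)
  qed
  show "set (path D x y) \<subseteq> open_arcs D \<inter> {i} \<times> UNIV"
    using a_open by (auto simp: path a_def)
  show "(\<Sum>a\<leftarrow>path D x y. M (tail D a) - M (head D a)) = M x - M y"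
    for M :: "passage \<Rightarrow> 'a::ab_group_add"
  proof -
    have "(\<Sum>a\<leftarrow>path D x y. M (tail D a) - M (head D a))
        = (\<Sum>t<m. M (tail D (a t)) - M (tail D (a (Suc t))))"
      by (simp add: path head_a comp_def interv_sum_list_conv_sum_set_nat atLeast0LessThan)
    also have "\<dots> = M (tail D (a 0)) - M (tail D (a m))"
      by (rule sum_lessThan_telescope')
    finally show ?thesis by (simp add: tail_0 tail_m)
  qed
qed

context parity_on_diagram
begin

lemma intersection_path:
  assumes "i < length (comps D)" "x \<in> set (comps D ! i)" "y \<in> set (comps D ! i)" "x \<noteq> y"
  shows "intersection D (chain (path D x y)) (parity_cycle p D) = potential x - potential y"
proof -
  have "(\<Sum>a\<leftarrow>path D x y. intersection D (chain [a]) (parity_cycle p D))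
      = (\<Sum>a\<leftarrow>path D x y. potential (tail D a) - potential (head D a))"
    using path_properties(5)[OF diagram assms] intersection_single_arc
    by (intro arg_cong[where f = sum_list] map_cong) auto
  then show ?thesis
    using path_properties(6)[OF diagram assms, of potential] intersection_sum_list by metis
qed

end

section \<open>The two formulas\<close>

lemma component_unique:
  assumes "diagram D" "i < length (comps D)" "j < length (comps D)"
    and "x \<in> set (comps D ! i)" "x \<in> set (comps D ! j)"
  shows "i = j"
  using assms nth_concat_inj[of "comps D" i j]
  by (auto simp: in_set_conv_nth diagram_def)

lemma arc_to_other_component:
  assumes D: "diagram D" and ij: "i < length (comps D)" "j < length (comps D)" "i \<noteq> j"
    and x: "x \<in> set (comps D ! i)" and w: "set w \<subseteq> open_arcs D \<inter> {j} \<times> UNIV"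
  shows "arc_to D x \<notin> set w"
proof
  assume "arc_to D x \<in> set w"
  then have "arc_to D x \<in> open_arcs D \<inter> {j} \<times> UNIV" using w by blast
  then obtain k where k: "arc_to D x = (j, k)" "k < length (comps D ! j)"
    by (auto simp: open_arcs_def)
  have "x \<in> set (concat (comps D))" using x ij(1) by (auto intro!: bexI[of _ "comps D ! i"])
  then have "fst x \<in> crossings D" unfolding crossings_def by blast
  then have "head D (arc_to D x) = x"
    using arc_to(2)[OF D, of "fst x" "snd x"] by simp
  moreover have "head D (j, k) \<in> set (comps D ! j)"
    unfolding head_def prod.case using k(2) by (intro nth_mem mod_less_divisor) linarith
  ultimately have "x \<in> set (comps D ! j)" using k(1) by simp
  then show False using component_unique[OF D ij(1,2) x] ij(3) by blast
qed

lemma goes_through_append: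
  assumes "us \<noteq> []" "vs \<noteq> []"
  shows "goes_through (us @ vs) (last us) (hd vs)" and "goes_through (us @ vs) (last vs) (hd us)"
proof -
  have len: "length us - 1 < length us" "Suc (length us - 1) = length us" using assms by simp_all
  then have "length us - 1 < length (us @ vs)" by (simp only: length_append trans_less_add1)
  with len show "goes_through (us @ vs) (last us) (hd vs)"
    unfolding goes_through_def using assms
    by (intro exI[of _ "length us - 1"]) (simp add: nth_append last_conv_nth hd_conv_nth)
  have "length us \<le> length us + length vs - 1" using assms by (cases vs) simp_all
  then show "goes_through (us @ vs) (last vs) (hd us)"
    unfolding goes_through_def using assms
    by (intro exI[of _ "length (us @ vs) - 1"]) (simp add: nth_append last_conv_nth hd_conv_nth)
qed

lemma passage_in_eq:
  assumes "diagram D" "i < length (comps D)" "j < length (comps D)" "i \<noteq> j"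
    and "(v, b) \<in> set (comps D ! i)" "(v, \<not> b) \<in> set (comps D ! j)"
  shows "passage_in D i v = (v, b)"
  unfolding passage_in_def
proof (rule the_equality)
  fix x assume x: "x \<in> set (comps D ! i) \<and> fst x = v"
  then have "x \<noteq> (v, \<not> b)" using assms component_unique by blast
  then show "x = (v, b)" using x by (cases x) auto
qed (use assms in simp)

context parity_on_diagram
begin

text \<open>
  If \<open>\<gamma>\<close> turns at \<open>v\<close> from the strand \<open>(v, b)\<close> to the other one, the incidence index is the sign
  with which the increment of the potential represents the parity. The index looks first for a turn
  from SW to NW; where \<open>\<gamma>\<close> turns from SE to NE, there is none because the arc that enters \<open>v\<close> on
  the other strand is off \<open>\<gamma>\<close>.
\<close>

lemma incidence_index_parity:
  assumes v: "v \<in> crossings D"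
    and turn: "goes_through \<gamma> (arc_to D (v, b)) (arc_from D (v, \<not> b))"
    and off: "arc_to D (v, \<not> b) \<notin> set \<gamma>"
  shows "int_scale (incidence_index D \<gamma> v) (p D v) = potential (v, \<not> b) - potential (v, b)"
proof (cases "b = positive D v")
  case True
  then have "incidence_index D \<gamma> v = 1"
    using turn by (simp add: incidence_index_def sw_def nw_def)
  then show ?thesis
    using True parity_eq_potential_difference[OF v] by (simp add: int_scale_def)
next
  case False
  then have b: "b = (\<not> positive D v)" by simp
  have "\<not> goes_through \<gamma> (sw D v) (nw D v)"
    using off unfolding goes_through_def sw_def b by (metis not_not nth_mem)
  then have "incidence_index D \<gamma> v = - 1"
    using turn by (simp add: incidence_index_def se_def ne_def b)
  then show ?thesis
    using parity_eq_potential_difference[OF v] by (simp add: int_scale_def b)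
qed

lemma self_crossing_parity:
  assumes i: "i < length (comps D)" and v: "self_crossing D i v"
  shows "p D v = intersection D (chain (left_half D v)) (parity_cycle p D)"
proof -
  have mem: "(v, b) \<in> set (comps D ! i)" for b
    using v by (cases b) (simp_all add: self_crossing_def)
  then have "v \<in> crossings D"
    using i by (force simp: crossings_def intro!: bexI[of _ "comps D ! i"])
  then show ?thesis
    using intersection_path[OF i mem mem] parity_eq_potential_difference
    by (simp add: left_half_def)
qed

text \<open>
  Each path contributes the difference of the potentials of its end passages. The two passages at
  \<open>v\<close> occur with opposite signs and combine to the term of \<open>v\<close>, likewise those at \<open>w\<close>.
\<close>

lemma mixed_crossings_parity:
  assumes ij: "i < length (comps D)" "j < length (comps D)" "i \<noteq> j" and vw: "v \<noteq> w"
    and mixed: "mixed_crossing D i j v" "mixed_crossing D i j w"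
    and \<gamma>: "\<gamma> = component_path D i v w @ component_path D j w v"
  shows "int_scale (incidence_index D \<gamma> v) (p D v) + int_scale (incidence_index D \<gamma> w) (p D w)
    = intersection D (chain \<gamma>) (parity_cycle p D)"
proof -
  obtain b where b: "(v, b) \<in> set (comps D ! i)" "(v, \<not> b) \<in> set (comps D ! j)"
    using mixed(1) by (auto simp: mixed_crossing_def)
  obtain c where c: "(w, c) \<in> set (comps D ! i)" "(w, \<not> c) \<in> set (comps D ! j)"
    using mixed(2) by (auto simp: mixed_crossing_def)
  have cr: "v \<in> crossings D" "w \<in> crossings D"
    using b(1) c(1) ij(1) by (force simp: crossings_def intro!: bexI[of _ "comps D ! i"])+
  define \<gamma>1 where "\<gamma>1 = path D (v, b) (w, c)"
  define \<gamma>2 where "\<gamma>2 = path D (w, \<not> c) (v, \<not> b)"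
  have "passage_in D i v = (v, b)" "passage_in D i w = (w, c)"
    using b c ij by (auto intro: passage_in_eq[OF diagram])
  moreover have "passage_in D j v = (v, \<not> b)" "passage_in D j w = (w, \<not> c)"
    using b c ij by (auto intro: passage_in_eq[OF diagram ij(2,1)])
  ultimately have \<gamma>: "\<gamma> = \<gamma>1 @ \<gamma>2"
    by (simp add: \<gamma> \<gamma>1_def \<gamma>2_def component_path_def)
  have ne: "(v, b) \<noteq> (w, c)" "(w, \<not> c) \<noteq> (v, \<not> b)" using vw by auto
  note g1 = path_properties[OF diagram ij(1) b(1) c(1) ne(1), folded \<gamma>1_def]
  note g2 = path_properties[OF diagram ij(2) c(2) b(2) ne(2), folded \<gamma>2_def]
  have "int_scale (incidence_index D \<gamma> v) (p D v) = potential (v, \<not> \<not> b) - potential (v, \<not> b)"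
  proof (rule incidence_index_parity[OF cr(1)])
    show "goes_through \<gamma> (arc_to D (v, \<not> b)) (arc_from D (v, \<not> \<not> b))"
      using goes_through_append(2)[OF g1(1) g2(1)] g1(2) g2(3) by (simp add: \<gamma>)
    show "arc_to D (v, \<not> \<not> b) \<notin> set \<gamma>"
      using g1(4) arc_to_other_component[OF diagram ij b(1) g2(5)] by (simp add: \<gamma>)
  qed
  moreover have "int_scale (incidence_index D \<gamma> w) (p D w) = potential (w, \<not> c) - potential (w, c)"
  proof (rule incidence_index_parity[OF cr(2)])
    show "goes_through \<gamma> (arc_to D (w, c)) (arc_from D (w, \<not> c))"
      using goes_through_append(1)[OF g1(1) g2(1)] g1(3) g2(2) by (simp add: \<gamma>)
    show "arc_to D (w, \<not> c) \<notin> set \<gamma>"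
      using g2(4) arc_to_other_component[OF diagram ij(2,1) ij(3)[symmetric] c(2) g1(5)]
      by (simp add: \<gamma>)
  qed
  moreover have "intersection D (chain \<gamma>) (parity_cycle p D)
      = (potential (v, b) - potential (w, c)) + (potential (w, \<not> c) - potential (v, \<not> b))"
    unfolding \<gamma> intersection_append \<gamma>1_def \<gamma>2_def
    using intersection_path[OF ij(1) b(1) c(1) ne(1)] intersection_path[OF ij(2) c(2) b(2) ne(2)]
    by simp
  ultimately show ?thesis by simp
qed

end

theorem theorem14:
  fixes p :: "vdiagram \<Rightarrow> nat \<Rightarrow> 'a::ab_group_add"
  assumes "virtual_link L" and "oriented_parity L p" and "D \<in> L"
  shows "(\<forall>i v. i < length (comps D) \<and> self_crossing D i v \<longrightarrow>
            p D v = intersection D (chain (left_half D v)) (parity_cycle p D)) \<and>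
         (\<forall>i j v w \<gamma>. i < length (comps D) \<and> j < length (comps D) \<and> i \<noteq> j \<and> v \<noteq> w \<and>
            mixed_crossing D i j v \<and> mixed_crossing D i j w \<and>
            \<gamma> = component_path D i v w @ component_path D j w v \<longrightarrow>
            int_scale (incidence_index D \<gamma> v) (p D v) + int_scale (incidence_index D \<gamma> w) (p D w)
              = intersection D (chain \<gamma>) (parity_cycle p D))"
proof -
  interpret parity_on_diagram L p D
    using assms by unfold_locales
  show ?thesis
    using self_crossing_parity mixed_crossings_parity by blast
qed

end
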